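(* Fix any $\lambda>0$. Assume that the joint distribution of $(X,y)$, with $X\in\mathbb{R}^{n\times p}$ and $y\in\mathbb{R}^n$, is absolutely continuous with respect to $(np+n)$-dimensional Lebesgue measure. Then the generalized lasso problem $$\min_{\beta\in\mathbb{R}^p}\ \tfrac12\|y-X\beta\|_2^2+\lambda\|D\beta\|_1$$ admits a unique solution almost surely, in any one of the following cases: (i) $D=I\in\mathbb{R}^{p\times p}$ is the identity matrix; (ii) $D\in\mathbb{R}^{(p-1)\times p}$ is the first difference matrix (fused lasso penalty matrix); (iii) $D\in\mathbb{R}^{(p-k-1)\times p}$ is the $(k+1)$st order difference matrix ($k$th order trend filtering penalty matrix), and $n\ge k+1$; (iv) $D\in\mathbb{R}^{m\times p}$ is the graph fused lasso penalty matrix, defined over a graph with $m$ edges, $p$ nodes, and $r$ connected components, and $n\ge r$; (v) $D$ is the $k$th order graph trend filtering penalty matrix, defined over a graph with $m$ edges, $p$ nodes, and $r$ connected components, and $n\ge r$; (vi) $D\in\mathbb{R}^{(N-k-1)N^{d-1}d\times N^d}$ is the $k$th order Kronecker trend filtering penalty matrix, defined over a $d$-dimensional grid graph with all equal side lengths $N=p^{1/d}$, and $n\ge (k+1)^d$.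
   Context: Throughout $k\ge 0$ is an integer. The penalty matrices are as follows. The first difference matrix $D^{(1)}_{(q)}\in\mathbb{R}^{(q-1)\times q}$ on $q$ points has $(D^{(1)}_{(q)}\beta)_i=\beta_{i+1}-\beta_i$, $i=1,\dots,q-1$. The $(k+1)$st order difference matrix on $q$ points, $D^{(k+1)}_{(q)}\in\mathbb{R}^{(q-k-1)\times q}$, is defined recursively by $D^{(k+1)}_{(q)}=D^{(1)}_{(q-k)}D^{(k)}_{(q)}$ for $k\ge1$. In cases (ii), (iii), $q=p$. For an undirected graph on nodes $\{1,\dots,p\}$ with $m$ edges, the graph fused lasso penalty matrix is the (oriented) edge incidence matrix $\Delta^{(1)}\in\mathbb{R}^{m\times p}$: the row corresponding to the edge $\{i,j\}$, $i<j$, has entry $-1$ in column $i$, $+1$ in column $j$, and zeros elsewhere. The $k$th order graph trend filtering penalty matrix is $\Delta^{(k+1)}$, where $\Delta^{(1)}$ is the edge incidence matrix and, for $k\ge1$, $\Delta^{(k+1)}=(\Delta^{(1)})^T\Delta^{(k)}$ if $k$ is odd (so it has $p$ rows) and $\Delta^{(k+1)}=\Delta^{(1)}\Delta^{(k)}$ if $k$ is even (so it has $m$ rows). The $k$th order Kronecker trend filtering penalty matrix over the $d$-dimensional grid with side length $N$ (so $p=N^d$) is the matrix obtained by stacking vertically the $d$ matrices $I_N\otimes\cdots\otimes I_N\otimes D^{(k+1)}_{(N)}\otimes I_N\otimes\cdots\otimes I_N$ ($d$ Kronecker factors), where $D^{(k+1)}_{(N)}\in\mathbb{R}^{(N-k-1)\times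 N}$ appears in the $j$th position, $j=1,\dots,d$, and $I_N$ is the $N\times N$ identity. *)

theory Defs
  imports
    "HOL-Probability.Probability"
    "Jordan_Normal_Form.Matrix"
    "Graph_Theory.Graph_Theory"
begin

text \<open>
  Matrices and vectors are those of \<^theory>\<open>Jordan_Normal_Form.Matrix\<close>: dimensions are natural
  numbers, and all indices (rows, columns, graph nodes, Kronecker positions) start at 0.
\<close>

hide_const (open) Finite_Cartesian_Product.vec Finite_Cartesian_Product.mat
no_notation vec_nth (infixl \<open>$\<close> 90)
no_notation inner (infix \<open>\<bullet>\<close> 70)

section \<open>The generalized lasso\<close>

definition l1_norm :: "real vec \<Rightarrow> real" where
  "l1_norm v = (\<Sum>i<dim_vec v. \<bar>v $ i\<bar>)"

definition l2_norm :: "real vec \<Rightarrow> real" where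
  "l2_norm v = sqrt (\<Sum>i<dim_vec v. (v $ i)\<^sup>2)"

definition gen_lasso_objective ::
    "real \<Rightarrow> real mat \<Rightarrow> real mat \<Rightarrow> real vec \<Rightarrow> real vec \<Rightarrow> real" where
  "gen_lasso_objective lam D X y \<beta> =
     1 / 2 * (l2_norm (y - X *\<^sub>v \<beta>))\<^sup>2 + lam * l1_norm (D *\<^sub>v \<beta>)"

definition gen_lasso_solution ::
    "real \<Rightarrow> real mat \<Rightarrow> real mat \<Rightarrow> real vec \<Rightarrow> real vec \<Rightarrow> bool" where
  "gen_lasso_solution lam D X y =
     is_arg_min (gen_lasso_objective lam D X y) (\<lambda>\<beta>. \<beta> \<in> carrier_vec (dim_col X))"

section \<open>Lebesgue measure on pairs (design matrix, response)\<close>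

text \<open>
  The spaces of n by p matrices and of n-vectors are identified with spaces of functions on
  their finite index sets, on which Lebesgue measure is the product of one-dimensional
  Lebesgue (Borel) measures.
\<close>

definition lborel_design :: "nat \<Rightarrow> nat \<Rightarrow> ((nat \<times> nat \<Rightarrow> real) \<times> (nat \<Rightarrow> real)) measure" where
  "lborel_design n p =
     (\<Pi>\<^sub>M ij\<in>{..<n} \<times> {..<p}. lborel) \<Otimes>\<^sub>M (\<Pi>\<^sub>M i\<in>{..<n}. lborel)"

definition design_coords :: "real mat \<Rightarrow> real vec \<Rightarrow> (nat \<times> nat \<Rightarrow> real) \<times> (nat \<Rightarrow> real)" where
  "design_coords X y =
     (restrict (\<lambda>ij. X $$ ij) ({..<dim_row X} \<times> {..<dim_col X}),
      restrict (\<lambda>i. y $ i) {..<dim_vec y})"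

section \<open>Difference matrices\<close>

definition first_diff_mat :: "nat \<Rightarrow> real mat" where
  "first_diff_mat q =
     mat (q - 1) q (\<lambda>(i, j). if j = Suc i then 1 else if j = i then - 1 else 0)"

text \<open>
  \<open>trend_filter_mat q k\<close> is the difference matrix of order \<open>k + 1\<close> on \<open>q\<close> points (note the shift).
  It is only meaningful for \<open>k + 1 \<le> q\<close>, since natural-number subtraction truncates.
\<close>

primrec trend_filter_mat :: "nat \<Rightarrow> nat \<Rightarrow> real mat" where
  "trend_filter_mat q 0 = first_diff_mat q"
| "trend_filter_mat q (Suc k) = first_diff_mat (q - Suc k) * trend_filter_mat q k"

section \<open>Graph penalties\<close>

text \<open>
  A simple undirected graph is a \<^locale>\<open>pair_graph\<close>, that is, a finite, loop-free, symmetric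
  set of arcs; each edge \<open>{i, j}\<close> with \<open>i < j\<close> is represented by its arc \<open>(i, j)\<close>. The list \<open>es\<close>
  fixes the order of the edges, i.e. of the rows of the incidence matrix.
\<close>

definition graph_on :: "nat \<Rightarrow> nat pair_pre_digraph \<Rightarrow> (nat \<times> nat) list \<Rightarrow> bool" where
  "graph_on p G es \<longleftrightarrow>
     pair_graph G \<and> pverts G = {..<p} \<and>
     distinct es \<and> set es = {(i, j). (i, j) \<in> parcs G \<and> i < j}"

text \<open>In a symmetric digraph the strong components are the components of the undirected graph.\<close>

definition num_components :: "nat pair_pre_digraph \<Rightarrow> nat" where
  "num_components G = card (pre_digraph.sccs (with_proj G))"

definition incidence_mat :: "nat \<Rightarrow> (nat \<times> nat) list \<Rightarrow> real mat" where
  "incidence_mat p es =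
     mat (length es) p (\<lambda>(e, v). if v = fst (es ! e) then - 1
                                 else if v = snd (es ! e) then 1 else 0)"

text \<open>\<open>graph_trend_filter_mat p es k\<close> is the graph difference operator of order \<open>k + 1\<close>.\<close>

primrec graph_trend_filter_mat :: "nat \<Rightarrow> (nat \<times> nat) list \<Rightarrow> nat \<Rightarrow> real mat" where
  "graph_trend_filter_mat p es 0 = incidence_mat p es"
| "graph_trend_filter_mat p es (Suc k) =
     (if odd (Suc k) then transpose_mat (incidence_mat p es) * graph_trend_filter_mat p es k
      else incidence_mat p es * graph_trend_filter_mat p es k)"

section \<open>Kronecker penalty\<close>

definition kronecker :: "real mat \<Rightarrow> real mat \<Rightarrow> real mat" where
  "kronecker A B =
     mat (dim_row A * dim_row B) (dim_col A * dim_col B)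
       (\<lambda>(i, j). A $$ (i div dim_row B, j div dim_col B) * B $$ (i mod dim_row B, j mod dim_col B))"

definition kronecker_list :: "real mat list \<Rightarrow> real mat" where
  "kronecker_list As = foldr kronecker As (1\<^sub>m 1)"

definition stack_rows :: "nat \<Rightarrow> real mat list \<Rightarrow> real mat" where
  "stack_rows nc As = foldr append_rows As (0\<^sub>m 0 nc)"

definition kronecker_trend_filter_mat :: "nat \<Rightarrow> nat \<Rightarrow> nat \<Rightarrow> real mat" where
  "kronecker_trend_filter_mat N d k =
     stack_rows (N ^ d)
       (map (\<lambda>j. kronecker_list (map (\<lambda>i. if i = j then trend_filter_mat N k else 1\<^sub>m N) [0..<d]))
         [0..<d])"

end

theory Submission
  imports Defs "Jordan_Normal_Form.Determinant"
begin

text \<open>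
  For almost every \<open>X\<close>, the solution is unique for every \<open>y\<close>. Let \<open>b \<noteq> c\<close> be solutions, with midpoint
  \<open>h\<close>, and let \<open>s\<close> be the sign vector of \<open>D h\<close>. By strict convexity of the squared norm, \<open>X b = X c\<close>,
  and \<open>D b\<close>, \<open>D c\<close> have the signs of \<open>D h\<close> where they do not vanish. The objective is smooth near \<open>h\<close>
  along the directions \<open>v\<close> for which \<open>D v\<close> vanishes wherever \<open>s\<close> does, so there
  \<open>(y - X h) \<bullet> X v = lam * (s \<bullet> D v)\<close>. Hence \<open>b - c\<close> is a nonzero element of the kernel of \<open>X\<close> in the
  subspace \<open>L\<^sub>s\<close> of those \<open>v\<close> with moreover \<open>s \<bullet> D v = 0\<close>. Now a generic \<open>X\<close> has full rank on each
  of the finitely many subspaces \<open>L\<^sub>s\<close>, so it maps \<open>L\<^sub>s\<close> onto the whole space; taking \<open>v\<close> in \<open>L\<^sub>s\<close> with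
  \<open>X v = X h\<close>, the equation at \<open>h - v\<close> gives \<open>s \<bullet> D h = 0\<close>, i.e. \<open>D h = 0\<close>, and so \<open>D b = D c = 0\<close>.
  But a generic \<open>X\<close> is injective on the kernel of \<open>D\<close>, whose dimension is at most \<open>n\<close>; that bound
  is obtained by exhibiting at most \<open>n\<close> coordinates that determine the elements of the kernel.
\<close>

section \<open>Zero sets of polynomial functions\<close>

text \<open>Polynomials are represented by their evaluation functions, with only the coordinates in
  \<open>I\<close> allowed; facts about them then follow by structural induction.\<close>

inductive poly_fun :: "'a set \<Rightarrow> (('a \<Rightarrow> real) \<Rightarrow> real) \<Rightarrow> bool" for I where
  poly_fun_const: "poly_fun I (\<lambda>x. c)"
| poly_fun_coord: "i \<in> I \<Longrightarrow> poly_fun I (\<lambda>x. x i)"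
| poly_fun_add: "poly_fun I f \<Longrightarrow> poly_fun I g \<Longrightarrow> poly_fun I (\<lambda>x. f x + g x)"
| poly_fun_mult: "poly_fun I f \<Longrightarrow> poly_fun I g \<Longrightarrow> poly_fun I (\<lambda>x. f x * g x)"

lemma poly_fun_sum: "(\<And>j. j \<in> A \<Longrightarrow> poly_fun I (f j)) \<Longrightarrow> poly_fun I (\<lambda>x. \<Sum>j\<in>A. f j x)"
  by (induction A rule: infinite_finite_induct) (auto intro: poly_fun.intros)

lemma poly_fun_prod: "(\<And>j. j \<in> A \<Longrightarrow> poly_fun I (f j)) \<Longrightarrow> poly_fun I (\<lambda>x. \<Prod>j\<in>A. f j x)"
  by (induction A rule: infinite_finite_induct) (auto intro: poly_fun.intros)

lemma poly_fun_measurable: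
  "poly_fun I f \<Longrightarrow> f \<in> borel_measurable (\<Pi>\<^sub>M i\<in>I. lborel)"
proof (induction rule: poly_fun.induct)
  case (poly_fun_coord i)
  then show ?case
    using measurable_component_singleton[of i I "\<lambda>_. lborel :: real measure"] by simp
qed auto

lemma poly_fun_empty: "poly_fun {} f \<Longrightarrow> f x = f y"
  by (induction rule: poly_fun.induct) auto

text \<open>On a line parallel to a coordinate axis the function is a univariate polynomial, which
  has finitely many roots unless it is zero. The witness depends on the base point
  \<open>x\<close>.\<close>

lemma poly_fun_upd_poly:
  assumes "poly_fun I f"
  shows "\<exists>P. \<forall>t. f (x(i := t)) = poly P t"
  using assms
proof (induction rule: poly_fun.induct)
  case (poly_fun_const c)
  show ?case by (rule exI[of _ "[:c:]"]) simp
next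
  case (poly_fun_coord j)
  show ?case by (cases "j = i") (auto intro: exI[of _ "[:0, 1:]"] exI[of _ "[:x j:]"])
next
  case (poly_fun_add f g)
  then obtain P Q where "\<forall>t. f (x(i := t)) = poly P t" "\<forall>t. g (x(i := t)) = poly Q t" by blast
  then show ?case by (intro exI[of _ "P + Q"]) (simp del: fun_upd_apply)
next
  case (poly_fun_mult f g)
  then obtain P Q where "\<forall>t. f (x(i := t)) = poly P t" "\<forall>t. g (x(i := t)) = poly Q t" by blast
  then show ?case by (intro exI[of _ "P * Q"]) (simp del: fun_upd_apply)
qed

lemma poly_fun_fix_coord:
  "poly_fun (insert i I) f \<Longrightarrow> poly_fun I (\<lambda>x. f (x(i := t)))"
proof (induction rule: poly_fun.induct)
  case (poly_fun_coord j)
  then show ?case by (cases "j = i") (auto intro: poly_fun.intros)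
qed (auto intro: poly_fun.intros)

text \<open>Fubini over one coordinate at a time: a nonzero polynomial in one variable has finitely many roots.\<close>

lemma AE_poly_fun_nonzero:
  assumes "finite I" "poly_fun I f" "f a \<noteq> 0"
  shows "AE x in (\<Pi>\<^sub>M i\<in>I. lborel). f x \<noteq> 0"
  using assms
proof (induction I arbitrary: f a rule: finite_induct)
  case empty
  then have "f x \<noteq> 0" for x using poly_fun_empty[OF empty(1), of x a] by simp
  then show ?case by simp
next
  case (insert i I)
  interpret product_sigma_finite "\<lambda>_. lborel :: real measure" ..
  let ?P = "\<Pi>\<^sub>M i\<in>I. (lborel :: real measure)" and ?Q = "\<Pi>\<^sub>M i\<in>insert i I. (lborel :: real measure)"
  let ?N = "{x \<in> space ?Q. f x = 0}"
  have [measurable]: "f \<in> borel_measurable ?Q" by (rule poly_fun_measurable) fact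
  have N: "?N \<in> sets ?Q" by measurable
  \<comment> \<open>Freezing coordinate \<open>i\<close> at \<open>a i\<close> keeps the function
    nonzero at \<open>a\<close>, because \<open>a(i := a i) = a\<close>; so the induction hypothesis
    applies.\<close>
  have "AE x in ?P. f (x(i := a i)) \<noteq> 0"
    using insert.IH[OF poly_fun_fix_coord[OF insert.prems(1)], of a "a i"] insert.prems(2)
    by (simp del: fun_upd_apply)
  then have ae: "AE x in ?P. (\<integral>\<^sup>+ t. indicator ?N (x(i := t)) \<partial>lborel) = 0"
  proof eventually_elim
    fix x assume x: "f (x(i := a i)) \<noteq> 0"
    obtain P where P: "\<And>t. f (x(i := t)) = poly P t"
      using poly_fun_upd_poly[OF insert.prems(1)] by blast
    from x P have "P \<noteq> 0" by auto
    then have fin: "finite {t. poly P t = 0}" by (rule poly_roots_finite)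
    have "(\<integral>\<^sup>+ t. indicator ?N (x(i := t)) \<partial>lborel) \<le> (\<integral>\<^sup>+ t. indicator {t. poly P t = 0} t \<partial>lborel)"
      by (intro nn_integral_mono) (auto simp: indicator_def P)
    also have "\<dots> = emeasure lborel {t. poly P t = 0}"
      using fin by (intro nn_integral_indicator) (auto intro: sets_lborel finite_imp_closed borel_closed)
    also have "\<dots> = 0" using fin by (rule emeasure_lborel_countable[OF countable_finite])
    finally show "(\<integral>\<^sup>+ t. indicator ?N (x(i := t)) \<partial>lborel) = 0" by simp
  qed
  have "emeasure ?Q ?N = (\<integral>\<^sup>+ x. indicator ?N x \<partial>?Q)" using N by simp
  also have "\<dots> = (\<integral>\<^sup>+ x. (\<integral>\<^sup>+ t. indicator ?N (x(i := t)) \<partial>lborel) \<partial>?P)"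
    using N by (intro product_nn_integral_insert insert) auto
  also have "\<dots> = (\<integral>\<^sup>+ x. 0 \<partial>?P)" by (rule nn_integral_cong_AE[OF ae])
  finally have "emeasure ?Q ?N = 0" by simp
  with N show ?case by (intro AE_I'[of ?N]) (auto simp: null_sets_def)
qed

section \<open>Generic matrices have full rank on a subspace\<close>

definition lin_subspace :: "nat \<Rightarrow> real vec set \<Rightarrow> bool" where
  "lin_subspace p L \<longleftrightarrow> L \<subseteq> carrier_vec p \<and> 0\<^sub>v p \<in> L \<and>
     (\<forall>u\<in>L. \<forall>v\<in>L. u + v \<in> L) \<and> (\<forall>c. \<forall>v\<in>L. c \<cdot>\<^sub>v v \<in> L)"

lemma lin_subspace_diff:
  assumes "lin_subspace p L" "u \<in> L" "v \<in> L"
  shows "u - v \<in> L"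
proof -
  have "u - v = u + (-1) \<cdot>\<^sub>v v"
    using assms by (intro eq_vecI) (auto simp: lin_subspace_def)
  then show ?thesis using assms by (simp add: lin_subspace_def)
qed

section \<open>Independent families encoded by left inverses\<close>

lemma vec_eq_0_iff_sprod_self: "z \<in> carrier_vec p \<Longrightarrow> z \<bullet> z = 0 \<longleftrightarrow> z = 0\<^sub>v p" for z :: "real vec"
  by (auto simp: scalar_prod_def sum_nonneg_eq_0_iff intro!: eq_vecI)

lemma mult_mat_vec_last_col:
  fixes U :: "real mat"
  assumes U: "U \<in> carrier_mat p q" and z: "z \<in> carrier_vec p" and c: "c \<in> carrier_vec (Suc q)"
  shows "mat p (Suc q) (\<lambda>(i, j). if j < q then U $$ (i, j) else z $ i) *\<^sub>v c
         = U *\<^sub>v vec q (\<lambda>i. c $ i) + (c $ q) \<cdot>\<^sub>v z"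
  using assms by (intro eq_vecI) (auto simp: scalar_prod_def)

text \<open>Gram-Schmidt: the new row of the left inverse is \<open>z - Y\<^sup>T U\<^sup>T z\<close>, normalised.\<close>

lemma left_inverse_extend:
  fixes U Y :: "real mat"
  assumes U: "U \<in> carrier_mat p q" and Y: "Y \<in> carrier_mat q p" and YU: "Y * U = 1\<^sub>m q"
    and z: "z \<in> carrier_vec p" "z \<noteq> 0\<^sub>v p" "Y *\<^sub>v z = 0\<^sub>v q"
  shows "\<exists>Y'\<in>carrier_mat (Suc q) p.
    Y' * mat p (Suc q) (\<lambda>(i, j). if j < q then U $$ (i, j) else z $ i) = 1\<^sub>m (Suc q)"
proof -
  define U' where "U' = mat p (Suc q) (\<lambda>(i, j). if j < q then U $$ (i, j) else z $ i)"
  define w where "w = transpose_mat U *\<^sub>v z"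
  define a where "a = z - transpose_mat Y *\<^sub>v w"
  define a' where "a' = (1 / (z \<bullet> z)) \<cdot>\<^sub>v a"
  define Y' where "Y' = mat (Suc q) p (\<lambda>(i, j). if i < q then Y $$ (i, j) else a' $ j)"
  have [simp]: "w \<in> carrier_vec q" using U z by (simp add: w_def)
  have [simp]: "a \<in> carrier_vec p" "a' \<in> carrier_vec p" using Y z by (simp_all add: a_def a'_def)
  have zz: "z \<bullet> z \<noteq> 0" using z vec_eq_0_iff_sprod_self by blast
  \<comment> \<open>With \<open>Y * U = 1\<^sub>m q\<close> and \<open>Y z = 0\<close> this formula
    makes \<open>a\<close> orthogonal to the columns of \<open>U\<close> and gives
    \<open>a \<bullet> z = z \<bullet> z\<close>.\<close>
  have a: "a \<bullet> v = z \<bullet> v - w \<bullet> (Y *\<^sub>v v)" if "v \<in> carrier_vec p" for v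
    using that z Y unfolding a_def
    by (simp add: minus_scalar_prod_distrib[of _ p] transpose_vec_mult_scalar[OF Y])
  have YUc: "Y *\<^sub>v (U *\<^sub>v c) = c" if "c \<in> carrier_vec q" for c
    using assoc_mult_mat_vec[OF Y U that] YU that by simp
  have aU: "a \<bullet> (U *\<^sub>v c) = 0" if "c \<in> carrier_vec q" for c
    using that U z by (simp add: a YUc w_def transpose_vec_mult_scalar)
  have az: "a \<bullet> z = z \<bullet> z" using z by (simp add: a)
  have colU: "col U j = U *\<^sub>v unit_vec q j" if "j < q" for j
    using that U by (intro eq_vecI) auto
  have [simp]: "dim_vec a' = p" by (rule carrier_vecD) simp
  have row: "row Y' i = (if i < q then row Y i else a')" if "i < Suc q" for i
    using that Y by (auto simp: Y'_def intro!: eq_vecI)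
  have col: "col U' j = (if j < q then col U j else z)" if "j < Suc q" for j
    using that U z by (auto simp: U'_def intro!: eq_vecI)
  have "Y' * U' = 1\<^sub>m (Suc q)"
  proof (rule eq_matI)
    fix i j assume "i < dim_row (1\<^sub>m (Suc q) :: real mat)" "j < dim_col (1\<^sub>m (Suc q) :: real mat)"
    then have ij: "i < Suc q" "j < Suc q" by auto
    have e: "(Y' * U') $$ (i, j) = row Y' i \<bullet> col U' j"
      using ij by (simp add: Y'_def U'_def)
    consider "i < q" "j < q" | "i < q" "j = q" | "i = q" "j < q" | "i = q" "j = q" using ij by linarith
    then show "(Y' * U') $$ (i, j) = 1\<^sub>m (Suc q) $$ (i, j)"
    proof cases
      case 1
      then have "row Y i \<bullet> col U j = (Y * U) $$ (i, j)" using U Y by simp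
      then show ?thesis unfolding e using 1 ij by (simp add: row col YU)
    next
      case 2
      then have "row Y i \<bullet> z = (Y *\<^sub>v z) $ i" using Y by simp
      then show ?thesis unfolding e using 2 ij z by (simp add: row col)
    next
      case 3
      then show ?thesis unfolding e using ij U aU[of "unit_vec q j"]
        by (simp add: row col a'_def colU smult_scalar_prod_distrib[of _ p])
    next
      case 4
      then show ?thesis unfolding e using ij zz z az
        by (simp add: row col a'_def smult_scalar_prod_distrib[of _ p])
    qed
  qed (auto simp: Y'_def U'_def)
  then show ?thesis unfolding U'_def by (intro bexI[of _ Y']) (auto simp: Y'_def)
qed

text \<open>A maximal independent family in \<open>L\<close> with at most \<open>n\<close> members:
  it spans \<open>L\<close> unless it has exactly \<open>n\<close> columns. The left inverse
  \<open>Y\<close> expresses independence as a matrix identity and later serves as a point where a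
  determinant is nonzero.\<close>

lemma ex_left_invertible_basis:
  fixes n :: nat
  assumes L: "lin_subspace p L"
  obtains q U Y where "q \<le> n" "U \<in> carrier_mat p q" "Y \<in> carrier_mat q p" "Y * U = 1\<^sub>m q"
    "\<And>c. c \<in> carrier_vec q \<Longrightarrow> U *\<^sub>v c \<in> L"
    "\<And>v. q < n \<Longrightarrow> v \<in> L \<Longrightarrow> \<exists>c\<in>carrier_vec q. v = U *\<^sub>v c"
proof -
  define P where "P q \<longleftrightarrow> q \<le> n \<and> (\<exists>U\<in>carrier_mat p q. \<exists>Y\<in>carrier_mat q p.
    Y * U = 1\<^sub>m q \<and> (\<forall>c\<in>carrier_vec q. U *\<^sub>v c \<in> L))" for q
  have "(0\<^sub>m p 0 :: real mat) *\<^sub>v c = 0\<^sub>v p" if "c \<in> carrier_vec 0" for c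
    using that by (intro eq_vecI) (auto simp: scalar_prod_def)
  moreover have "(0\<^sub>m 0 p :: real mat) * 0\<^sub>m p 0 = 1\<^sub>m 0" by (rule eq_matI) auto
  ultimately have "P 0" unfolding P_def using L
    by (intro conjI bexI[of _ "0\<^sub>m p 0"] bexI[of _ "0\<^sub>m 0 p"]) (auto simp: lin_subspace_def)
  moreover have "\<forall>q. P q \<longrightarrow> q \<le> n" by (simp add: P_def)
  ultimately obtain q where q: "P q" and max: "\<And>r. P r \<Longrightarrow> r \<le> q"
    using Greatest_le_nat[of P _ n] GreatestI_nat[of P 0 n] by blast
  from q obtain U Y where U: "U \<in> carrier_mat p q" and Y: "Y \<in> carrier_mat q p"
    and YU: "Y * U = 1\<^sub>m q" and UL: "\<And>c. c \<in> carrier_vec q \<Longrightarrow> U *\<^sub>v c \<in> L" and "q \<le> n"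
    unfolding P_def by blast
  have "\<exists>c\<in>carrier_vec q. v = U *\<^sub>v c" if "q < n" "v \<in> L" for v
  proof -
    have v: "v \<in> carrier_vec p" using that L by (auto simp: lin_subspace_def)
    \<comment> \<open>The residual of \<open>v\<close> after the projection \<open>U * Y\<close>. It
      lies in \<open>L\<close> and in the kernel of \<open>Y\<close>, so if nonzero it would enlarge
      the maximal family.\<close>
    define z where "z = v - U *\<^sub>v (Y *\<^sub>v v)"
    have Yv: "Y *\<^sub>v v \<in> carrier_vec q" using Y v by simp
    have zL: "z \<in> L" unfolding z_def using lin_subspace_diff[OF L that(2) UL[OF Yv]] .
    then have zc: "z \<in> carrier_vec p" using L by (auto simp: lin_subspace_def)
    have "Y *\<^sub>v (U *\<^sub>v (Y *\<^sub>v v)) = Y *\<^sub>v v"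
      using assoc_mult_mat_vec[OF Y U Yv] YU Yv by simp
    then have Yz: "Y *\<^sub>v z = 0\<^sub>v q"
      unfolding z_def using Y U v Yv by (simp add: mult_minus_distrib_mat_vec[OF Y])
    have "z = 0\<^sub>v p"
    proof (rule ccontr)
      assume "z \<noteq> 0\<^sub>v p"
      let ?U = "mat p (Suc q) (\<lambda>(i, j). if j < q then U $$ (i, j) else z $ i)"
      obtain Y' where "Y' \<in> carrier_mat (Suc q) p" "Y' * ?U = 1\<^sub>m (Suc q)"
        using left_inverse_extend[OF U Y YU zc \<open>z \<noteq> 0\<^sub>v p\<close> Yz] by blast
      moreover have "?U *\<^sub>v c \<in> L" if "c \<in> carrier_vec (Suc q)" for c
        unfolding mult_mat_vec_last_col[OF U zc that]
        using L zL UL[of "vec q (\<lambda>i. c $ i)"] by (simp add: lin_subspace_def)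
      ultimately have "P (Suc q)" using \<open>q < n\<close> unfolding P_def
        by (intro conjI Suc_leI bexI[of _ ?U] bexI[of _ Y'] ballI) auto
      then show False using max by fastforce
    qed
    then have "v - U *\<^sub>v (Y *\<^sub>v v) = 0\<^sub>v p" by (simp add: z_def)
    then have "v = U *\<^sub>v (Y *\<^sub>v v)"
      using v U Yv by (auto simp: vec_eq_iff)
    then show ?thesis using Yv by blast
  qed
  with that U Y YU UL \<open>q \<le> n\<close> show ?thesis by blast
qed

section \<open>Generic determinants\<close>

lemma det_nonzero_solvable:
  fixes A :: "real mat"
  assumes A: "A \<in> carrier_mat q q" and "Determinant.det A \<noteq> 0" and b: "b \<in> carrier_vec q"
  shows "\<exists>c\<in>carrier_vec q. A *\<^sub>v c = b"
proof -
  obtain B where B: "B \<in> carrier_mat q q" "A * B = 1\<^sub>m q"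
    using det_non_zero_imp_unit[OF assms(1,2), of "()"] by (auto simp: Units_def ring_mat_def)
  then have "A *\<^sub>v (B *\<^sub>v b) = b" using assoc_mult_mat_vec[OF A B(1) b] b by simp
  then show ?thesis using B b by (intro bexI[of _ "B *\<^sub>v b"]) auto
qed

text \<open>By the Leibniz formula. Only the first \<open>q\<close> rows of the design enter, and
  \<open>q \<le> n\<close> keeps their indices in the index set.\<close>

lemma poly_fun_det:
  assumes U: "U \<in> carrier_mat p q" and "q \<le> n"
  shows "poly_fun ({..<n} \<times> {..<p}) (\<lambda>x. Determinant.det (mat q p x * U))"
proof -
  have "mat q p x * U \<in> carrier_mat q q" for x by (rule mult_carrier_mat[OF mat_carrier U])
  moreover have "(mat q p x * U) $$ (i, j) = (\<Sum>k<p. x (i, k) * U $$ (k, j))" if "i < q" "j < q" for x i j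
    using that U by (auto simp: scalar_prod_def lessThan_atLeast0)
  ultimately have "(\<lambda>x. Determinant.det (mat q p x * U)) =
    (\<lambda>x. \<Sum>\<pi> | \<pi> permutes {0..<q}. signof \<pi> * (\<Prod>i = 0..<q. \<Sum>k<p. x (i, k) * U $$ (k, \<pi> i)))"
    by (subst det_def') (auto simp: permutes_in_image intro!: ext sum.cong prod.cong)
  then show ?thesis using \<open>q \<le> n\<close>
    by (auto intro!: poly_fun_sum poly_fun_prod poly_fun.intros)
qed

text \<open>The polynomial is not identically zero: at the entries of \<open>Y\<close> the matrix
  becomes \<open>1\<^sub>m q\<close>.\<close>

lemma AE_det_nonzero:
  fixes U Y :: "real mat"
  assumes U: "U \<in> carrier_mat p q" and Y: "Y \<in> carrier_mat q p" "Y * U = 1\<^sub>m q" and "q \<le> n"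
  shows "AE x in (\<Pi>\<^sub>M ij\<in>{..<n} \<times> {..<p}. lborel). Determinant.det (mat q p x * U) \<noteq> 0"
proof -
  have "mat q p (($$) Y) = Y" using Y by (intro eq_matI) auto
  then have "Determinant.det (mat q p (($$) Y) * U) \<noteq> 0" using Y by simp
  then show ?thesis
    by (intro AE_poly_fun_nonzero[of _ _ "($$) Y"] poly_fun_det U \<open>q \<le> n\<close>) auto
qed

text \<open>A trivial kernel on \<open>L\<close>, which amounts to injectivity when \<open>L\<close>
  is a subspace.\<close>

definition inj_on_subspace :: "real mat \<Rightarrow> real vec set \<Rightarrow> bool" where
  "inj_on_subspace X L \<longleftrightarrow> (\<forall>v\<in>L. X *\<^sub>v v = 0\<^sub>v (dim_row X) \<longrightarrow> v = 0\<^sub>v (dim_col X))"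

text \<open>The first \<open>q\<close> rows of the design are already injective on the column span
  of \<open>U\<close>.\<close>

lemma inj_on_subspace_spanned:
  assumes U: "U \<in> carrier_mat p q" and "q \<le> n" and det: "Determinant.det (mat q p x * U) \<noteq> 0"
    and span: "\<And>v. v \<in> L \<Longrightarrow> \<exists>c\<in>carrier_vec q. v = U *\<^sub>v c"
  shows "inj_on_subspace (mat n p x) L"
  unfolding inj_on_subspace_def
proof (intro ballI impI)
  fix v assume v: "v \<in> L" and X: "mat n p x *\<^sub>v v = 0\<^sub>v (dim_row (mat n p x))"
  obtain c where c: "c \<in> carrier_vec q" "v = U *\<^sub>v c" using span[OF v] by blast
  have T: "mat q p x * U \<in> carrier_mat q q" by (rule mult_carrier_mat[OF mat_carrier U])
  have "mat q p x *\<^sub>v v = 0\<^sub>v q"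
  proof (rule eq_vecI)
    fix i assume "i < dim_vec (0\<^sub>v q :: real vec)"
    then have i: "i < q" "i < n" using \<open>q \<le> n\<close> by auto
    then have "row (mat q p x) i = row (mat n p x) i" by (intro eq_vecI) auto
    then have "(mat q p x *\<^sub>v v) $ i = (mat n p x *\<^sub>v v) $ i" using i by simp
    then show "(mat q p x *\<^sub>v v) $ i = 0\<^sub>v q $ i" using i by (simp add: X)
  qed simp
  then have "(mat q p x * U) *\<^sub>v c = 0\<^sub>v q"
    using assoc_mult_mat_vec[of "mat q p x" q p U q c] U c by simp
  then have "c = 0\<^sub>v q" using det det_0_iff_vec_prod_zero_field[OF T] c by blast
  then show "v = 0\<^sub>v (dim_col (mat n p x))" using c U by (auto intro!: eq_vecI)
qed

text \<open>One nonzero determinant serves both alternatives: for \<open>q < n\<close> the columns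
  of \<open>U\<close> span \<open>L\<close> and it gives injectivity; for \<open>q = n\<close> it
  makes the design times \<open>U\<close> invertible, so \<open>L\<close> is mapped onto
  everything.\<close>

lemma generic_full_rank:
  assumes L: "lin_subspace p L"
  shows "AE x in (\<Pi>\<^sub>M ij\<in>{..<n} \<times> {..<p}. lborel).
    inj_on_subspace (mat n p x) L \<or> (\<forall>b\<in>carrier_vec n. \<exists>v\<in>L. mat n p x *\<^sub>v v = b)"
proof -
  obtain q U Y where q: "q \<le> n" and U: "U \<in> carrier_mat p q" and Y: "Y \<in> carrier_mat q p" "Y * U = 1\<^sub>m q"
    and UL: "\<And>c. c \<in> carrier_vec q \<Longrightarrow> U *\<^sub>v c \<in> L"
    and span: "\<And>v. q < n \<Longrightarrow> v \<in> L \<Longrightarrow> \<exists>c\<in>carrier_vec q. v = U *\<^sub>v c"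
    using ex_left_invertible_basis[OF L] by blast
  from AE_det_nonzero[OF U Y q] show ?thesis
  proof eventually_elim
    fix x assume det: "Determinant.det (mat q p x * U) \<noteq> 0"
    show "inj_on_subspace (mat n p x) L \<or> (\<forall>b\<in>carrier_vec n. \<exists>v\<in>L. mat n p x *\<^sub>v v = b)"
    proof (cases "q < n")
      case True
      then show ?thesis using inj_on_subspace_spanned[OF U q det] span by blast
    next
      case False
      then have "q = n" using q by simp
      have "\<exists>v\<in>L. mat n p x *\<^sub>v v = b" if b: "b \<in> carrier_vec n" for b
      proof -
        obtain c where "c \<in> carrier_vec n" "(mat n p x * U) *\<^sub>v c = b"
          using det_nonzero_solvable[OF mult_carrier_mat[OF mat_carrier U] det, of b] b
          unfolding \<open>q = n\<close> by blast
        then show ?thesis using UL U unfolding \<open>q = n\<close>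
          by (intro bexI[of _ "U *\<^sub>v c"]) (auto simp: assoc_mult_mat_vec[of _ n p _ n])
      qed
      then show ?thesis by blast
    qed
  qed
qed

text \<open>One injective design \<open>X0\<close> limits the dimension of \<open>L\<close> to
  \<open>n\<close>. Hence \<open>U\<close> spans \<open>L\<close> also when \<open>q = n\<close>:
  \<open>X0 * U\<close> is then invertible, so some vector of the span has the same image as
  \<open>v\<close> and equals it by injectivity.\<close>

lemma generic_injective:
  assumes L: "lin_subspace p L" and X0: "X0 \<in> carrier_mat n p" and inj: "inj_on_subspace X0 L"
  shows "AE x in (\<Pi>\<^sub>M ij\<in>{..<n} \<times> {..<p}. lborel). inj_on_subspace (mat n p x) L"
proof -
  obtain q U Y where q: "q \<le> n" and U: "U \<in> carrier_mat p q" and Y: "Y \<in> carrier_mat q p" "Y * U = 1\<^sub>m q"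
    and UL: "\<And>c. c \<in> carrier_vec q \<Longrightarrow> U *\<^sub>v c \<in> L"
    and span: "\<And>v. q < n \<Longrightarrow> v \<in> L \<Longrightarrow> \<exists>c\<in>carrier_vec q. v = U *\<^sub>v c"
    using ex_left_invertible_basis[OF L] by blast
  have "\<exists>c\<in>carrier_vec q. v = U *\<^sub>v c" if v: "v \<in> L" for v
  proof (cases "q < n")
    case False
    then have [simp]: "q = n" using q by simp
    have vc: "v \<in> carrier_vec p" using L v by (auto simp: lin_subspace_def)
    have A: "X0 * U \<in> carrier_mat n n" using X0 U by simp
    have XU: "(X0 * U) *\<^sub>v c = X0 *\<^sub>v (U *\<^sub>v c)" if "c \<in> carrier_vec n" for c
      using assoc_mult_mat_vec[OF X0, of U n c] U that by simp
    have "c = 0\<^sub>v n" if "c \<in> carrier_vec n" "(X0 * U) *\<^sub>v c = 0\<^sub>v n" for c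
    proof -
      have "U *\<^sub>v c = 0\<^sub>v p" using inj UL[of c] that X0 by (simp add: inj_on_subspace_def XU)
      then have "(Y * U) *\<^sub>v c = Y *\<^sub>v 0\<^sub>v p" using assoc_mult_mat_vec[OF Y(1) U, of c] that by simp
      then show ?thesis using Y that by (auto intro!: eq_vecI)
    qed
    then have "Determinant.det (X0 * U) \<noteq> 0" using det_0_iff_vec_prod_zero_field[OF A] by blast
    then obtain c where c: "c \<in> carrier_vec n" "(X0 * U) *\<^sub>v c = X0 *\<^sub>v v"
      using det_nonzero_solvable[OF A _ mult_mat_vec_carrier[OF X0 vc]] by blast
    then have "X0 *\<^sub>v (v - U *\<^sub>v c) = 0\<^sub>v n"
      using mult_minus_distrib_mat_vec[OF X0 vc, of "U *\<^sub>v c"] U X0 vc by (simp add: XU)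
    moreover have "v - U *\<^sub>v c \<in> L" using lin_subspace_diff[OF L v UL[of c]] c by simp
    ultimately have "v - U *\<^sub>v c = 0\<^sub>v p" using inj X0 by (auto simp: inj_on_subspace_def)
    then have "v = U *\<^sub>v c" using vc U by (auto simp: vec_eq_iff)
    then show ?thesis using c by auto
  qed (use span v in blast)
  then show ?thesis
    using AE_det_nonzero[OF U Y q] inj_on_subspace_spanned[OF U q] by (auto elim!: eventually_mono)
qed

section \<open>Solutions of the generalized lasso\<close>

lemma l2_norm_sq: "(l2_norm v)\<^sup>2 = v \<bullet> v"
  by (simp add: l2_norm_def sum_nonneg scalar_prod_def power2_eq_square lessThan_atLeast0)

text \<open>The inequality makes 0 a local minimum of a quadratic polynomial; a small step against
  the sign of \<open>a\<close> would go below it.\<close>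

lemma linear_coeff_zero:
  fixes a b :: real
  assumes "e > 0" and "\<And>t. \<bar>t\<bar> < e \<Longrightarrow> 0 \<le> a * t + b * t\<^sup>2"
  shows "a = 0"
proof (rule ccontr)
  assume a: "a \<noteq> 0"
  \<comment> \<open>Small enough for the linear term to dominate the quadratic one; the 1 avoids a
    zero denominator.\<close>
  define s where "s = min (e / 2) (\<bar>a\<bar> / (2 * (\<bar>b\<bar> + 1)))"
  have s: "s > 0" "s < e" using a \<open>e > 0\<close> by (auto simp: s_def)
  have "s * (2 * (\<bar>b\<bar> + 1)) \<le> \<bar>a\<bar>" using pos_le_divide_eq[of "2 * (\<bar>b\<bar> + 1)" s "\<bar>a\<bar>"] by (simp add: s_def)
  then have *: "2 * s * \<bar>b\<bar> < \<bar>a\<bar>" using s by (simp add: algebra_simps)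
  have "0 \<le> a * (- sgn a * s) + b * (- sgn a * s)\<^sup>2"
    using s a by (intro assms(2)) (simp add: abs_mult abs_sgn_eq)
  also have "\<dots> = s * (b * s - \<bar>a\<bar>)"
    using a by (simp add: power_mult_distrib power2_eq_square algebra_simps flip: abs_sgn)
  finally have "\<bar>a\<bar> \<le> b * s" using s by (simp add: zero_le_mult_iff)
  also have "\<dots> \<le> \<bar>b\<bar> * s" using s by (intro mult_right_mono) auto
  finally show False using * s a by (simp add: algebra_simps)
qed

lemma sgn_add_small:
  fixes a b :: real
  assumes "a \<noteq> 0" "\<bar>b\<bar> < \<bar>a\<bar>"
  shows "\<bar>a + b\<bar> = \<bar>a\<bar> + sgn a * b"
  using assms by (auto simp: sgn_if abs_if split: if_splits)

text \<open>Near \<open>b\<close> the nonzero entries of \<open>D b\<close> keep their signs, and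
  the zero entries stay zero along \<open>v\<close> by \<open>zero\<close>; so each absolute value
  is linear in \<open>t\<close>.\<close>

lemma l1_norm_locally_linear:
  assumes D: "D \<in> carrier_mat m p" and b: "b \<in> carrier_vec p" and v: "v \<in> carrier_vec p"
    and zero: "\<And>i. i < m \<Longrightarrow> (D *\<^sub>v b) $ i = 0 \<Longrightarrow> (D *\<^sub>v v) $ i = 0"
  shows "\<exists>e>0. \<forall>t. \<bar>t\<bar> < e \<longrightarrow> l1_norm (D *\<^sub>v (b + t \<cdot>\<^sub>v v)) =
    l1_norm (D *\<^sub>v b) + t * (\<Sum>i<m. sgn ((D *\<^sub>v b) $ i) * (D *\<^sub>v v) $ i)"
proof -
  let ?a = "\<lambda>i. (D *\<^sub>v b) $ i" and ?c = "\<lambda>i. (D *\<^sub>v v) $ i"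
  have "\<exists>e>0. \<forall>t. \<bar>t\<bar> < e \<longrightarrow> \<bar>?a i + t * ?c i\<bar> = \<bar>?a i\<bar> + t * (sgn (?a i) * ?c i)" if "i < m" for i
  proof (cases "?a i = 0")
    case True
    then show ?thesis using zero[OF that] by (intro exI[of _ 1]) auto
  next
    case False
    have "\<bar>?a i + t * ?c i\<bar> = \<bar>?a i\<bar> + t * (sgn (?a i) * ?c i)"
      if t: "\<bar>t\<bar> < \<bar>?a i\<bar> / (\<bar>?c i\<bar> + 1)" for t
    proof -
      have "\<bar>t * ?c i\<bar> \<le> \<bar>t\<bar> * (\<bar>?c i\<bar> + 1)" by (simp add: abs_mult algebra_simps)
      also have "\<dots> < \<bar>?a i\<bar>" using t pos_less_divide_eq[of "\<bar>?c i\<bar> + 1" "\<bar>t\<bar>" "\<bar>?a i\<bar>"] by simp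
      finally show ?thesis using sgn_add_small[OF False, of "t * ?c i"] by simp
    qed
    then show ?thesis using False by (intro exI[of _ "\<bar>?a i\<bar> / (\<bar>?c i\<bar> + 1)"]) auto
  qed
  then have "\<forall>i\<in>{..<m}. \<exists>e>0. \<forall>t. \<bar>t\<bar> < e \<longrightarrow> \<bar>?a i + t * ?c i\<bar> = \<bar>?a i\<bar> + t * (sgn (?a i) * ?c i)"
    by simp
  from bchoice[OF this] obtain e where e: "\<And>i. i < m \<Longrightarrow> e i > 0"
    "\<And>i t. i < m \<Longrightarrow> \<bar>t\<bar> < e i \<Longrightarrow> \<bar>?a i + t * ?c i\<bar> = \<bar>?a i\<bar> + t * (sgn (?a i) * ?c i)"
    by auto
  \<comment> \<open>The 1 keeps the set nonempty when \<open>m = 0\<close>.\<close>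
  define d where "d = Min (insert 1 (e ` {..<m}))"
  have d: "d > 0" "\<And>i. i < m \<Longrightarrow> d \<le> e i" using e(1) by (auto simp: d_def)
  have "(D *\<^sub>v (b + t \<cdot>\<^sub>v v)) $ i = ?a i + t * ?c i" if "i < m" for i t
    using that D b v by (simp add: mult_add_distrib_mat_vec[OF D] mult_mat_vec)
  then have "l1_norm (D *\<^sub>v (b + t \<cdot>\<^sub>v v)) = (\<Sum>i<m. \<bar>?a i + t * ?c i\<bar>)" for t
    using D by (simp add: l1_norm_def)
  also have "(\<Sum>i<m. \<bar>?a i + t * ?c i\<bar>) = (\<Sum>i<m. \<bar>?a i\<bar> + t * (sgn (?a i) * ?c i))" if "\<bar>t\<bar> < d" for t
    by (intro sum.cong e(2)) (use d that in \<open>fastforce+\<close>)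
  finally show ?thesis using d(1) D
    by (intro exI[of _ d]) (auto simp: l1_norm_def sum.distrib sum_distrib_left)
qed

text \<open>Along \<open>b + t v\<close> the objective is quadratic for small \<open>t\<close> and
  minimal at 0, so its linear coefficient vanishes. The restriction to such directions gives an
  equation in place of a subgradient inclusion.\<close>

lemma gen_lasso_first_order:
  assumes X: "X \<in> carrier_mat n p" and D: "D \<in> carrier_mat m p" and y: "y \<in> carrier_vec n"
    and sol: "gen_lasso_solution lam D X y b" and v: "v \<in> carrier_vec p"
    and zero: "\<And>i. i < m \<Longrightarrow> (D *\<^sub>v b) $ i = 0 \<Longrightarrow> (D *\<^sub>v v) $ i = 0"
  shows "(y - X *\<^sub>v b) \<bullet> (X *\<^sub>v v) = lam * (\<Sum>i<m. sgn ((D *\<^sub>v b) $ i) * (D *\<^sub>v v) $ i)"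
proof -
  have b: "b \<in> carrier_vec p"
    and min: "\<And>u. u \<in> carrier_vec p \<Longrightarrow> gen_lasso_objective lam D X y b \<le> gen_lasso_objective lam D X y u"
    using sol X by (auto simp: gen_lasso_solution_def is_arg_min_linorder)
  define S where "S = (\<Sum>i<m. sgn ((D *\<^sub>v b) $ i) * (D *\<^sub>v v) $ i)"
  define r where "r = y - X *\<^sub>v b"
  have r: "r \<in> carrier_vec n" using X y b by (simp add: r_def)
  have Xv: "X *\<^sub>v v \<in> carrier_vec n" using X v by simp
  obtain e where e: "e > 0" "\<And>t. \<bar>t\<bar> < e \<Longrightarrow>
      l1_norm (D *\<^sub>v (b + t \<cdot>\<^sub>v v)) = l1_norm (D *\<^sub>v b) + t * S"
    using l1_norm_locally_linear[OF D b v zero] unfolding S_def by blast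
  have "0 \<le> (lam * S - r \<bullet> (X *\<^sub>v v)) * t + 1 / 2 * ((X *\<^sub>v v) \<bullet> (X *\<^sub>v v)) * t\<^sup>2" if t: "\<bar>t\<bar> < e" for t
  proof -
    have "y - X *\<^sub>v (b + t \<cdot>\<^sub>v v) = r - t \<cdot>\<^sub>v (X *\<^sub>v v)"
      using X y b v by (intro eq_vecI) (auto simp: r_def mult_add_distrib_mat_vec[OF X] mult_mat_vec)
    then have "(l2_norm (y - X *\<^sub>v (b + t \<cdot>\<^sub>v v)))\<^sup>2 =
        r \<bullet> r - 2 * t * (r \<bullet> (X *\<^sub>v v)) + t\<^sup>2 * ((X *\<^sub>v v) \<bullet> (X *\<^sub>v v))"
      unfolding l2_norm_sq using r Xv by (simp add: minus_scalar_prod_distrib[of _ n] scalar_prod_minus_distrib[of _ n]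
        comm_scalar_prod[OF Xv r] power2_eq_square algebra_simps)
    then show ?thesis using min[of "b + t \<cdot>\<^sub>v v"] b v e(2)[OF t]
      by (simp add: gen_lasso_objective_def l2_norm_sq flip: r_def) (simp add: field_simps)
  qed
  from linear_coeff_zero[OF e(1) this] show ?thesis by (simp add: S_def r_def)
qed

text \<open>Strict convexity of the squared norm, and convexity of the penalty.\<close>

lemma gen_lasso_solutions_fit:
  assumes lam: "lam > 0" and X: "X \<in> carrier_mat n p" and D: "D \<in> carrier_mat m p" and y: "y \<in> carrier_vec n"
    and sol: "gen_lasso_solution lam D X y b" "gen_lasso_solution lam D X y c"
  shows "X *\<^sub>v b = X *\<^sub>v c"
    and "gen_lasso_solution lam D X y ((1 / 2) \<cdot>\<^sub>v (b + c))"
    and "\<And>i. i < m \<Longrightarrow> \<bar>(D *\<^sub>v b) $ i\<bar> + \<bar>(D *\<^sub>v c) $ i\<bar> = 2 * \<bar>(D *\<^sub>v ((1 / 2) \<cdot>\<^sub>v (b + c))) $ i\<bar>"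
proof -
  let ?f = "gen_lasso_objective lam D X y"
  define h where "h = (1 / 2) \<cdot>\<^sub>v (b + c)"
  have bc: "b \<in> carrier_vec p" "c \<in> carrier_vec p"
    and min: "\<And>u. u \<in> carrier_vec p \<Longrightarrow> ?f b \<le> ?f u" "\<And>u. u \<in> carrier_vec p \<Longrightarrow> ?f c \<le> ?f u"
    using sol X by (auto simp: gen_lasso_solution_def is_arg_min_linorder)
  have h: "h \<in> carrier_vec p" using bc by (simp add: h_def)
  define r s where "r = y - X *\<^sub>v b" and "s = y - X *\<^sub>v c"
  have rs: "r \<in> carrier_vec n" "s \<in> carrier_vec n" using X y bc by (auto simp: r_def s_def)
  have "y - X *\<^sub>v h = (1 / 2) \<cdot>\<^sub>v (r + s)"
    using X y bc by (intro eq_vecI) (auto simp: r_def s_def h_def mult_add_distrib_mat_vec[OF X] mult_mat_vec field_simps)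
  moreover have "(r - s) \<bullet> (r - s) = r \<bullet> r - 2 * (r \<bullet> s) + s \<bullet> s"
    "((1 / 2) \<cdot>\<^sub>v (r + s)) \<bullet> ((1 / 2) \<cdot>\<^sub>v (r + s)) = 1 / 4 * (r \<bullet> r + 2 * (r \<bullet> s) + s \<bullet> s)"
    using rs by (simp_all add: minus_scalar_prod_distrib[of _ n] scalar_prod_minus_distrib[of _ n]
      add_scalar_prod_distrib[of _ n] scalar_prod_add_distrib[of _ n] comm_scalar_prod[OF rs(2,1)] algebra_simps)
  \<comment> \<open>Relative to the average of the two squared residuals, the midpoint gains a
    quarter of their squared distance.\<close>
  ultimately have quad: "(l2_norm (y - X *\<^sub>v h))\<^sup>2 =
      1 / 2 * (l2_norm r)\<^sup>2 + 1 / 2 * (l2_norm s)\<^sup>2 - 1 / 4 * ((r - s) \<bullet> (r - s))"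
    by (simp add: l2_norm_sq) (simp add: field_simps)
  have Dh: "(D *\<^sub>v h) $ i = 1 / 2 * ((D *\<^sub>v b) $ i + (D *\<^sub>v c) $ i)" if "i < m" for i
    using that D bc by (simp add: h_def mult_add_distrib_mat_vec[OF D] mult_mat_vec)
  \<comment> \<open>The convexity defect of the absolute value in row \<open>i\<close>; for
    \<open>i < m\<close> it is zero exactly when the entries of \<open>D b\<close> and
    \<open>D c\<close> do not have opposite signs.\<close>
  define g where "g i = 1 / 2 * \<bar>(D *\<^sub>v b) $ i\<bar> + 1 / 2 * \<bar>(D *\<^sub>v c) $ i\<bar> - \<bar>(D *\<^sub>v h) $ i\<bar>" for i
  have g: "g i \<ge> 0" if "i < m" for i using Dh[OF that] by (simp add: g_def)
  have "(\<Sum>i<m. g i) = 1 / 2 * l1_norm (D *\<^sub>v b) + 1 / 2 * l1_norm (D *\<^sub>v c) - l1_norm (D *\<^sub>v h)"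
    using D by (simp add: g_def l1_norm_def sum.distrib sum_subtractf sum_divide_distrib)
  then have l1: "l1_norm (D *\<^sub>v h) = 1 / 2 * l1_norm (D *\<^sub>v b) + 1 / 2 * l1_norm (D *\<^sub>v c) - (\<Sum>i<m. g i)"
    by simp
  then have eq: "?f h = 1 / 2 * ?f b + 1 / 2 * ?f c - 1 / 8 * ((r - s) \<bullet> (r - s)) - lam * (\<Sum>i<m. g i)"
    unfolding gen_lasso_objective_def quad l1 by (simp add: r_def[symmetric] s_def[symmetric] field_simps)
  have "(r - s) \<bullet> (r - s) \<ge> 0" by (simp add: scalar_prod_def sum_nonneg)
  moreover have "lam * (\<Sum>i<m. g i) \<ge> 0"
    using lam g by (intro mult_nonneg_nonneg sum_nonneg) auto
  moreover note eq min[OF h]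
  \<comment> \<open>The midpoint cannot fall below the minimum and both defects are nonnegative, so
    both are zero.\<close>
  ultimately have 0: "(r - s) \<bullet> (r - s) = 0" "lam * (\<Sum>i<m. g i) = 0" and fh: "?f h = ?f b"
    using min(1)[OF bc(2)] min(2)[OF bc(1)] by argo+
  have "r - s = 0\<^sub>v n" using 0(1) rs
    by (auto simp: scalar_prod_def sum_nonneg_eq_0_iff intro!: eq_vecI)
  then have "(y - X *\<^sub>v b) $ i = (y - X *\<^sub>v c) $ i" if "i < n" for i
    using that rs by (metis (no_types) carrier_vecD index_minus_vec(1) index_zero_vec(1) r_def s_def right_minus_eq)
  then show "X *\<^sub>v b = X *\<^sub>v c" using X y bc by (intro eq_vecI) auto
  show "gen_lasso_solution lam D X y ((1 / 2) \<cdot>\<^sub>v (b + c))"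
    using min(1) h fh X by (auto simp: gen_lasso_solution_def is_arg_min_linorder simp flip: h_def)
  fix i assume i: "i < m"
  have "\<forall>i\<in>{..<m}. g i = 0"
    using 0(2) lam g by (subst sum_nonneg_eq_0_iff[symmetric]) auto
  then have "g i = 0" using i by blast
  then show "\<bar>(D *\<^sub>v b) $ i\<bar> + \<bar>(D *\<^sub>v c) $ i\<bar> = 2 * \<bar>(D *\<^sub>v ((1 / 2) \<cdot>\<^sub>v (b + c))) $ i\<bar>"
    unfolding g_def h_def by linarith
qed

text \<open>The subspace \<open>L\<^sub>s\<close> of the argument above. It depends on
  \<open>D\<close> and \<open>s\<close> alone, so genericity can be required for all sign vectors at
  once, before any solution is known.\<close>

definition sign_subspace :: "real mat \<Rightarrow> (nat \<Rightarrow> real) \<Rightarrow> real vec set" where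
  "sign_subspace D s = {v \<in> carrier_vec (dim_col D).
     (\<forall>i<dim_row D. s i = 0 \<longrightarrow> (D *\<^sub>v v) $ i = 0) \<and> (\<Sum>i<dim_row D. s i * (D *\<^sub>v v) $ i) = 0}"

text \<open>The deterministic core: genericity enters only through \<open>inj\<close> and
  \<open>generic\<close>, which concern \<open>X\<close> and \<open>D\<close> but not
  \<open>y\<close>.\<close>

lemma gen_lasso_solution_unique:
  assumes lam: "lam > 0" and X: "X \<in> carrier_mat n p" and D: "D \<in> carrier_mat m p" and y: "y \<in> carrier_vec n"
    and inj: "inj_on_subspace X {v \<in> carrier_vec p. D *\<^sub>v v = 0\<^sub>v m}"
    and generic: "\<And>s. s \<in> {..<m} \<rightarrow>\<^sub>E {-1, 0, 1} \<Longrightarrow>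
      inj_on_subspace X (sign_subspace D s) \<or> (\<forall>b\<in>carrier_vec n. \<exists>v\<in>sign_subspace D s. X *\<^sub>v v = b)"
    and sol: "gen_lasso_solution lam D X y b" "gen_lasso_solution lam D X y c"
  shows "b = c"
proof (rule ccontr)
  assume "b \<noteq> c"
  have bc: "b \<in> carrier_vec p" "c \<in> carrier_vec p"
    using sol X by (auto simp: gen_lasso_solution_def is_arg_min_linorder)
  define h where "h = (1 / 2) \<cdot>\<^sub>v (b + c)"
  define d where "d = b - c"
  have h: "h \<in> carrier_vec p" and d: "d \<in> carrier_vec p" using bc by (auto simp: h_def d_def)
  note fit = gen_lasso_solutions_fit[OF lam X D y sol, folded h_def]
  have Dd: "(D *\<^sub>v d) $ i = (D *\<^sub>v b) $ i - (D *\<^sub>v c) $ i" if "i < m" for i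
    using that D bc by (simp add: d_def mult_minus_distrib_mat_vec[OF D])
  have Xd: "X *\<^sub>v d = 0\<^sub>v n"
    using X bc fit(1) by (simp add: d_def mult_minus_distrib_mat_vec[OF X])
  have d0: "d \<noteq> 0\<^sub>v p"
  proof
    assume "d = 0\<^sub>v p"
    then have "b $ i - c $ i = 0" if "i < p" for i
      using that bc by (metis carrier_vecD d_def index_minus_vec(1) index_zero_vec(1))
    then show False using \<open>b \<noteq> c\<close> bc by (auto simp: vec_eq_iff)
  qed
  \<comment> \<open>The restriction makes \<open>s\<close> a member of the finite set of extensional
    sign functions.\<close>
  define s where "s = restrict (\<lambda>i. sgn ((D *\<^sub>v h) $ i)) {..<m}"
  have s: "s \<in> {..<m} \<rightarrow>\<^sub>E {-1, 0, 1}" by (auto simp: s_def sgn_if)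
  have first: "(y - X *\<^sub>v h) \<bullet> (X *\<^sub>v v) = lam * (\<Sum>i<m. s i * (D *\<^sub>v v) $ i)"
    if "v \<in> carrier_vec p" "\<And>i. i < m \<Longrightarrow> (D *\<^sub>v h) $ i = 0 \<Longrightarrow> (D *\<^sub>v v) $ i = 0" for v
    using gen_lasso_first_order[OF X D y fit(2) that] by (simp add: s_def)
  have r: "y - X *\<^sub>v h \<in> carrier_vec n" using X y h by simp
  \<comment> \<open>If entry \<open>i\<close> of \<open>D h\<close> is zero, both absolute values in
    \<open>fit(3)\<close> are zero.\<close>
  have zero: "(D *\<^sub>v d) $ i = 0" if "i < m" "(D *\<^sub>v h) $ i = 0" for i
    using fit(3)[OF that(1)] Dd[OF that(1)] that(2) by simp
  \<comment> \<open>The first-order equation in direction \<open>d\<close>: its left side vanishes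
    with \<open>X d\<close>, and \<open>lam\<close> is positive.\<close>
  have "(\<Sum>i<m. s i * (D *\<^sub>v d) $ i) = 0"
    using first[OF d zero] lam r by (simp add: Xd)
  then have "d \<in> sign_subspace D s" using d D zero by (auto simp: sign_subspace_def s_def sgn_if)
  then have "\<not> inj_on_subspace X (sign_subspace D s)" using Xd d0 X by (auto simp: inj_on_subspace_def)
  then obtain v where v: "v \<in> sign_subspace D s" "X *\<^sub>v v = X *\<^sub>v h"
    using generic[OF s] X h by (metis carrier_matD(1) carrier_vecI dim_mult_mat_vec)
  have vp: "v \<in> carrier_vec p" using v D by (simp add: sign_subspace_def)
  have Dhv: "(D *\<^sub>v (h - v)) $ i = (D *\<^sub>v h) $ i - (D *\<^sub>v v) $ i" if "i < m" for i
    using that D h vp by (simp add: mult_minus_distrib_mat_vec[OF D])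
  have "X *\<^sub>v (h - v) = 0\<^sub>v n" using X h vp v by (simp add: mult_minus_distrib_mat_vec[OF X])
  \<comment> \<open>The direction \<open>h - v\<close> is admissible, since \<open>D h\<close> and
    \<open>D v\<close> both vanish where \<open>s\<close> does, and \<open>X\<close> annihilates
    it.\<close>
  then have "(\<Sum>i<m. s i * (D *\<^sub>v (h - v)) $ i) = 0"
    using first[of "h - v"] h vp v D lam r Dhv by (auto simp: sign_subspace_def s_def)
  moreover have "(\<Sum>i<m. s i * (D *\<^sub>v (h - v)) $ i) =
      (\<Sum>i<m. s i * (D *\<^sub>v h) $ i) - (\<Sum>i<m. s i * (D *\<^sub>v v) $ i)"
    unfolding sum_subtractf[symmetric] by (intro sum.cong) (auto simp: Dhv right_diff_distrib simp del: index_mult_mat_vec)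
  ultimately have "(\<Sum>i<m. s i * (D *\<^sub>v h) $ i) = 0"
    using v D by (auto simp: sign_subspace_def simp del: index_mult_mat_vec)
  then have "(\<Sum>i<m. \<bar>(D *\<^sub>v h) $ i\<bar>) = 0" by (simp add: s_def abs_sgn mult.commute)
  then have "\<forall>i\<in>{..<m}. \<bar>(D *\<^sub>v h) $ i\<bar> = 0" by (subst sum_nonneg_eq_0_iff[symmetric]) auto
  then have "(D *\<^sub>v d) $ i = 0" if "i < m" for i using that zero by simp
  then have "D *\<^sub>v d = 0\<^sub>v m" using D by (intro eq_vecI) auto
  then show False using inj d Xd d0 X by (auto simp: inj_on_subspace_def)
qed

section \<open>Existence of a solution by coercivity\<close>

lemma joint_left_inverse:
  fixes X D :: "real mat"
  assumes X: "X \<in> carrier_mat n p" and D: "D \<in> carrier_mat m p"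
    and inj: "inj_on_subspace X {v \<in> carrier_vec p. D *\<^sub>v v = 0\<^sub>v m}"
  obtains B C where "B \<in> carrier_mat p n" "C \<in> carrier_mat p m"
    "\<And>v. v \<in> carrier_vec p \<Longrightarrow> v = B *\<^sub>v (X *\<^sub>v v) + C *\<^sub>v (D *\<^sub>v v)"
proof -
  let ?XT = "transpose_mat X" and ?DT = "transpose_mat D"
  \<comment> \<open>The quadratic form of \<open>G\<close> is the sum of the squared norms of
    \<open>X v\<close> and \<open>D v\<close>, so by \<open>inj\<close> its kernel is trivial;
    \<open>B\<close> and \<open>C\<close> are the inverse of \<open>G\<close> times the two
    transposes.\<close>
  define G where "G = ?XT * X + ?DT * D"
  have XT: "?XT \<in> carrier_mat p n" and DT: "?DT \<in> carrier_mat p m" using X D by auto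
  have G: "G \<in> carrier_mat p p" using X D by (auto simp: G_def)
  have Gv: "G *\<^sub>v v = ?XT *\<^sub>v (X *\<^sub>v v) + ?DT *\<^sub>v (D *\<^sub>v v)" if "v \<in> carrier_vec p" for v
    using add_mult_distrib_mat_vec[of "?XT * X" p p "?DT * D" v] that X D XT DT
    by (simp add: G_def assoc_mult_mat_vec[OF XT X] assoc_mult_mat_vec[OF DT D])
  have "v = 0\<^sub>v p" if v: "v \<in> carrier_vec p" "G *\<^sub>v v = 0\<^sub>v p" for v
  proof -
    have Xv: "X *\<^sub>v v \<in> carrier_vec n" and Dv: "D *\<^sub>v v \<in> carrier_vec m" using X D v by auto
    have "0 = (G *\<^sub>v v) \<bullet> v" using v by simp
    also have "\<dots> = (X *\<^sub>v v) \<bullet> (X *\<^sub>v v) + (D *\<^sub>v v) \<bullet> (D *\<^sub>v v)"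
      unfolding Gv[OF v(1)] using XT DT Xv Dv v
      by (subst add_scalar_prod_distrib[of _ p])
        (auto simp: transpose_vec_mult_scalar[OF X v(1) Xv] transpose_vec_mult_scalar[OF D v(1) Dv])
    finally have "(X *\<^sub>v v) \<bullet> (X *\<^sub>v v) + (D *\<^sub>v v) \<bullet> (D *\<^sub>v v) = 0" by simp
    moreover have "(X *\<^sub>v v) \<bullet> (X *\<^sub>v v) \<ge> 0" "(D *\<^sub>v v) \<bullet> (D *\<^sub>v v) \<ge> 0"
      by (simp_all add: scalar_prod_def sum_nonneg)
    ultimately have "X *\<^sub>v v = 0\<^sub>v n" "D *\<^sub>v v = 0\<^sub>v m"
      using vec_eq_0_iff_sprod_self[OF Xv] vec_eq_0_iff_sprod_self[OF Dv] by linarith+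
    then show ?thesis using inj v X by (auto simp: inj_on_subspace_def)
  qed
  then have "Determinant.det G \<noteq> 0" using det_0_iff_vec_prod_zero_field[OF G] by blast
  then obtain H where H: "H \<in> carrier_mat p p" "H * G = 1\<^sub>m p"
    using det_non_zero_imp_unit[OF G, of "()"] by (auto simp: Units_def ring_mat_def)
  show thesis
  proof (rule that[of "H * ?XT" "H * ?DT"])
    fix v :: "real vec" assume v: "v \<in> carrier_vec p"
    have Xv: "X *\<^sub>v v \<in> carrier_vec n" and Dv: "D *\<^sub>v v \<in> carrier_vec m" using X D v by auto
    have "v = H *\<^sub>v (G *\<^sub>v v)" using assoc_mult_mat_vec[OF H(1) G v] H v by simp
    also have "\<dots> = H *\<^sub>v (?XT *\<^sub>v (X *\<^sub>v v)) + H *\<^sub>v (?DT *\<^sub>v (D *\<^sub>v v))"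
      unfolding Gv[OF v] using XT DT Xv Dv by (intro mult_add_distrib_mat_vec[OF H(1)]) auto
    finally show "v = H * ?XT *\<^sub>v (X *\<^sub>v v) + H * ?DT *\<^sub>v (D *\<^sub>v v)"
      using assoc_mult_mat_vec[OF H(1) XT Xv] assoc_mult_mat_vec[OF H(1) DT Dv] by simp
  qed (use H XT DT in auto)
qed

lemma abs_mult_mat_vec_le:
  fixes B :: "real mat"
  assumes B: "B \<in> carrier_mat p n" and w: "w \<in> carrier_vec n" and i: "i < p"
    and c: "\<And>j. j < n \<Longrightarrow> \<bar>w $ j\<bar> \<le> c"
  shows "\<bar>(B *\<^sub>v w) $ i\<bar> \<le> (\<Sum>k<p. \<Sum>j<n. \<bar>B $$ (k, j)\<bar>) * c"
proof -
  have "(B *\<^sub>v w) $ i = (\<Sum>j<n. B $$ (i, j) * w $ j)"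
    using B w i by (simp add: scalar_prod_def lessThan_atLeast0)
  also have "\<bar>\<dots>\<bar> \<le> (\<Sum>j<n. \<bar>B $$ (i, j)\<bar> * c)"
    by (rule order_trans[OF sum_abs]) (auto simp: abs_mult intro!: sum_mono mult_left_mono c)
  also have "\<dots> \<le> (\<Sum>k<p. \<Sum>j<n. \<bar>B $$ (k, j)\<bar> * c)"
    using i order_trans[OF abs_ge_zero c]
    by (intro member_le_sum[of i "{..<p}" "\<lambda>k. \<Sum>j<n. \<bar>B $$ (k, j)\<bar> * c"] sum_nonneg mult_nonneg_nonneg) auto
  finally show ?thesis by (simp add: sum_distrib_right)
qed

text \<open>Vectors of length \<open>p\<close> are modelled by functions that vanish from index
  \<open>p\<close> on, so the box is a product of compact sets and Tychonoff's theorem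
  applies.\<close>

lemma compact_box: "compact {x :: nat \<Rightarrow> real. \<forall>i. x i \<in> (if i < p then {-C..C} else {0})}"
proof -
  have "{x :: nat \<Rightarrow> real. \<forall>i. x i \<in> (if i < p then {-C..C} else {0})} =
      PiE UNIV (\<lambda>i. if i < p then {-C..C} else {0})"
    by (simp add: PiE_def Pi_def extensional_def)
  moreover have "compactin (product_topology (\<lambda>_ :: nat. euclidean) UNIV)
      (PiE UNIV (\<lambda>i. if i < p then {-C..C :: real} else {0}))"
    by (subst compactin_PiE) auto
  ultimately show ?thesis by (simp add: euclidean_product_topology)
qed

lemma gen_lasso_objective_vec:
  assumes X: "X \<in> carrier_mat n p" and D: "D \<in> carrier_mat m p" and y: "y \<in> carrier_vec n"
  shows "gen_lasso_objective lam D X y (vec p x) =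
    1 / 2 * (\<Sum>i<n. (y $ i - (\<Sum>j<p. X $$ (i, j) * x j))\<^sup>2) +
    lam * (\<Sum>i<m. \<bar>\<Sum>j<p. D $$ (i, j) * x j\<bar>)"
  using assms by (auto simp: gen_lasso_objective_def l2_norm_def l1_norm_def sum_nonneg
    scalar_prod_def lessThan_atLeast0 intro!: sum.cong)

text \<open>Where the objective is at most its value \<open>F\<close> at 0, \<open>X v\<close> and
  \<open>D v\<close> are bounded, and \<open>v\<close> is a fixed linear function of them. So this
  sublevel set lies in a compact box, on which the continuous objective attains its minimum.\<close>

lemma gen_lasso_solution_exists:
  assumes lam: "lam > 0" and X: "X \<in> carrier_mat n p" and D: "D \<in> carrier_mat m p" and y: "y \<in> carrier_vec n"
    and inj: "inj_on_subspace X {v \<in> carrier_vec p. D *\<^sub>v v = 0\<^sub>v m}"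
  shows "\<exists>b. gen_lasso_solution lam D X y b"
proof -
  let ?f = "gen_lasso_objective lam D X y"
  obtain B C where B: "B \<in> carrier_mat p n" and C: "C \<in> carrier_mat p m"
    and BC: "\<And>v. v \<in> carrier_vec p \<Longrightarrow> v = B *\<^sub>v (X *\<^sub>v v) + C *\<^sub>v (D *\<^sub>v v)"
    using joint_left_inverse[OF X D inj] by blast
  define F where "F = ?f (0\<^sub>v p)"
  \<comment> \<open>One bound for both: the first two terms control the entries of
    \<open>X v\<close>, the last one those of \<open>D v\<close>.\<close>
  define c where "c = (\<Sum>i<n. \<bar>y $ i\<bar>) + sqrt (2 * F) + F / lam"
  define R where "R = ((\<Sum>k<p. \<Sum>j<n. \<bar>B $$ (k, j)\<bar>) + (\<Sum>k<p. \<Sum>j<m. \<bar>C $$ (k, j)\<bar>)) * c"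
  have l1: "l1_norm w \<ge> 0" for w by (simp add: l1_norm_def sum_nonneg)
  have F0: "F \<ge> 0" using lam l1 by (auto simp: F_def gen_lasso_objective_def)
  have bound: "\<bar>v $ i\<bar> \<le> R" if v: "v \<in> carrier_vec p" and fv: "?f v \<le> F" and i: "i < p" for v i
  proof -
    have Xv: "X *\<^sub>v v \<in> carrier_vec n" and Dv: "D *\<^sub>v v \<in> carrier_vec m" using X D v by auto
    have "0 \<le> lam * l1_norm (D *\<^sub>v v)" using lam l1 by auto
    then have rF: "(l2_norm (y - X *\<^sub>v v))\<^sup>2 \<le> 2 * F"
      using fv unfolding gen_lasso_objective_def by linarith
    have Fl: "F / lam \<ge> 0" using F0 lam by simp
    have Xc: "\<bar>(X *\<^sub>v v) $ j\<bar> \<le> c" if j: "j < n" for j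
    proof -
      have "((y - X *\<^sub>v v) $ j)\<^sup>2 \<le> (\<Sum>j<n. ((y - X *\<^sub>v v) $ j)\<^sup>2)"
        using j by (intro member_le_sum) auto
      also have "\<dots> = (l2_norm (y - X *\<^sub>v v))\<^sup>2"
        using X by (simp add: l2_norm_def sum_nonneg)
      finally have "\<bar>y $ j - (X *\<^sub>v v) $ j\<bar>\<^sup>2 \<le> 2 * F" using rF X j by simp
      then have "\<bar>y $ j - (X *\<^sub>v v) $ j\<bar> \<le> sqrt (2 * F)" by (rule real_le_rsqrt)
      moreover have "\<bar>y $ j\<bar> \<le> (\<Sum>i<n. \<bar>y $ i\<bar>)" using j by (intro member_le_sum) auto
      ultimately show ?thesis using Fl unfolding c_def by linarith
    qed
    have Dc: "\<bar>(D *\<^sub>v v) $ j\<bar> \<le> c" if j: "j < m" for j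
    proof -
      have "0 \<le> (l2_norm (y - X *\<^sub>v v))\<^sup>2" by simp
      then have "lam * l1_norm (D *\<^sub>v v) \<le> F"
        using fv unfolding gen_lasso_objective_def by linarith
      then have "l1_norm (D *\<^sub>v v) \<le> F / lam" using lam by (simp add: field_simps)
      moreover have "\<bar>(D *\<^sub>v v) $ j\<bar> \<le> l1_norm (D *\<^sub>v v)"
        using j D unfolding l1_norm_def by (intro member_le_sum) auto
      moreover have "(\<Sum>i<n. \<bar>y $ i\<bar>) \<ge> 0" "sqrt (2 * F) \<ge> 0" using F0 by (auto intro: sum_nonneg)
      ultimately show ?thesis unfolding c_def by linarith
    qed
    have "v $ i = (B *\<^sub>v (X *\<^sub>v v)) $ i + (C *\<^sub>v (D *\<^sub>v v)) $ i"
      using arg_cong[OF BC[OF v], of "\<lambda>w. w $ i"] i C by simp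
    moreover note abs_mult_mat_vec_le[OF B Xv i Xc] abs_mult_mat_vec_le[OF C Dv i Dc]
    ultimately show ?thesis unfolding R_def distrib_right by linarith
  qed
  define K where "K = {x :: nat \<Rightarrow> real. \<forall>i. x i \<in> (if i < p then {-R..R} else {0})}"
  have inK: "(\<lambda>i. if i < p then v $ i else 0) \<in> K" if "v \<in> carrier_vec p" "?f v \<le> F" for v
    using bound[OF that] by (fastforce simp: K_def abs_le_iff)
  have eq: "vec p (\<lambda>i. if i < p then v $ i else 0) = v" if "v \<in> carrier_vec p" for v :: "real vec"
    using that by auto
  have "compact K" unfolding K_def by (rule compact_box)
  moreover have "K \<noteq> {}" using inK[of "0\<^sub>v p"] by (auto simp: F_def)
  moreover have "continuous_on K (\<lambda>x. ?f (vec p x))"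
    unfolding gen_lasso_objective_vec[OF X D y]
    by (intro continuous_intros continuous_on_subset[OF continuous_on_product_coordinates]) auto
  ultimately obtain x where x: "x \<in> K" "\<And>z. z \<in> K \<Longrightarrow> ?f (vec p x) \<le> ?f (vec p z)"
    using continuous_attains_inf[of K "\<lambda>x. ?f (vec p x)"] by blast
  \<comment> \<open>Outside the sublevel set the comparison goes through the zero vector, which lies
    in the box.\<close>
  have "?f (vec p x) \<le> ?f v" if v: "v \<in> carrier_vec p" for v
  proof (cases "?f v \<le> F")
    case True
    then show ?thesis using x(2)[OF inK[OF v]] by (simp add: eq[OF v])
  next
    case False
    then show ?thesis using x(2)[OF inK[of "0\<^sub>v p"]] eq[of "0\<^sub>v p"] by (simp add: F_def)
  qed
  then have "gen_lasso_solution lam D X y (vec p x)"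
    using X by (auto simp: gen_lasso_solution_def is_arg_min_linorder)
  then show ?thesis ..
qed

section \<open>Coordinates determining the null space of a penalty\<close>

text \<open>A certificate that the kernel of \<open>D\<close> has dimension at most
  \<open>card S\<close>: reading off the coordinates in \<open>S\<close> is injective on it.\<close>

definition coord_determined :: "nat \<Rightarrow> real mat \<Rightarrow> nat set \<Rightarrow> bool" where
  "coord_determined p D S \<longleftrightarrow> dim_col D = p \<and> S \<subseteq> {..<p} \<and>
     (\<forall>v\<in>carrier_vec p. D *\<^sub>v v = 0\<^sub>v (dim_row D) \<longrightarrow> (\<forall>i\<in>S. v $ i = 0) \<longrightarrow> v = 0\<^sub>v p)"

lemma coord_determined_one: "coord_determined p (1\<^sub>m p) {}"
  by (simp add: coord_determined_def)

lemma mult_mat_vec_index_sum: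
  assumes A: "A \<in> carrier_mat r c" and v: "v \<in> carrier_vec c" and i: "i < r"
  shows "(A *\<^sub>v v) $ i = (\<Sum>j<c. A $$ (i, j) * v $ j)"
proof -
  have "(A *\<^sub>v v) $ i = (\<Sum>j\<in>{0..<c}. row A i $ j * v $ j)"
    using A v i by (simp add: scalar_prod_def)
  also have "\<dots> = (\<Sum>j\<in>{0..<c}. A $$ (i, j) * v $ j)"
    using A i by (intro sum.cong refl) simp
  finally show ?thesis by (simp only: lessThan_atLeast0)
qed

section \<open>Difference matrices\<close>

lemma first_diff_mat_carrier: "first_diff_mat q \<in> carrier_mat (q - 1) q"
  by (simp add: first_diff_mat_def)

lemma first_diff_mult_vec:
  assumes "v \<in> carrier_vec q" "i < q - 1"
  shows "(first_diff_mat q *\<^sub>v v) $ i = v $ Suc i - v $ i"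
proof -
  have "(first_diff_mat q *\<^sub>v v) $ i = (\<Sum>j<q. first_diff_mat q $$ (i, j) * v $ j)"
    by (rule mult_mat_vec_index_sum[OF first_diff_mat_carrier assms])
  also have "\<dots> = (\<Sum>j<q. (if j = Suc i then v $ j else 0) - (if j = i then v $ j else 0))"
    using assms by (intro sum.cong refl) (simp add: first_diff_mat_def)
  also have "\<dots> = v $ Suc i - v $ i"
    using assms by (simp add: sum_subtractf)
  finally show ?thesis .
qed

lemma first_diff_null:
  assumes v: "v \<in> carrier_vec q" and 0: "first_diff_mat q *\<^sub>v v = 0\<^sub>v (q - 1)" and v0: "q > 0 \<Longrightarrow> v $ 0 = 0"
  shows "v = 0\<^sub>v q"
proof -
  have "i < q \<Longrightarrow> v $ i = 0" for i
  proof (induction i)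
    case (Suc i)
    then show ?case using first_diff_mult_vec[OF v, of i] by (simp add: 0)
  qed (use v0 in simp)
  then show ?thesis using v by (intro eq_vecI) auto
qed

lemma trend_filter_mat_carrier: "trend_filter_mat q k \<in> carrier_mat (q - Suc k) q"
proof (induction k)
  case (Suc k)
  then show ?case using mult_carrier_mat[OF first_diff_mat_carrier Suc] by simp
qed (use first_diff_mat_carrier[of q] in simp)

lemma trend_filter_mult_vec_Suc:
  assumes "v \<in> carrier_vec q"
  shows "trend_filter_mat q (Suc k) *\<^sub>v v = first_diff_mat (q - Suc k) *\<^sub>v (trend_filter_mat q k *\<^sub>v v)"
  using assoc_mult_mat_vec[OF first_diff_mat_carrier trend_filter_mat_carrier assms] by simp

text \<open>Row \<open>i\<close> is supported on the columns \<open>i\<close> to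
  \<open>i + k + 1\<close>, since every further difference adds one column.\<close>

lemma trend_filter_local:
  assumes v: "v \<in> carrier_vec q"
  shows "i < q - Suc k \<Longrightarrow> (\<And>j. i \<le> j \<Longrightarrow> j \<le> i + Suc k \<Longrightarrow> v $ j = 0) \<Longrightarrow> (trend_filter_mat q k *\<^sub>v v) $ i = 0"
proof (induction k arbitrary: i)
  case 0
  then show ?case using first_diff_mult_vec[OF v, of i] by simp
next
  case (Suc k)
  have c: "trend_filter_mat q k *\<^sub>v v \<in> carrier_vec (q - Suc k)"
    by (rule mult_mat_vec_carrier[OF trend_filter_mat_carrier v])
  have "(trend_filter_mat q k *\<^sub>v v) $ Suc i = 0" "(trend_filter_mat q k *\<^sub>v v) $ i = 0"
    using Suc.prems by (auto intro!: Suc.IH)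
  then show ?case
    unfolding trend_filter_mult_vec_Suc[OF v] using Suc.prems(1) by (subst first_diff_mult_vec[OF c]) auto
qed

text \<open>In the induction step \<open>k + 2\<close> leading zeros of \<open>v\<close> make the
  first entry of its difference of order \<open>k + 1\<close> zero; as the first differences of that
  vector vanish, it is zero throughout.\<close>

lemma trend_filter_null:
  assumes v: "v \<in> carrier_vec q"
  shows "trend_filter_mat q k *\<^sub>v v = 0\<^sub>v (q - Suc k) \<Longrightarrow> (\<And>i. i \<le> k \<Longrightarrow> i < q \<Longrightarrow> v $ i = 0) \<Longrightarrow> v = 0\<^sub>v q"
proof (induction k)
  case 0
  then show ?case using first_diff_null[OF v] by simp
next
  case (Suc k)
  let ?w = "trend_filter_mat q k *\<^sub>v v"
  have c: "?w \<in> carrier_vec (q - Suc k)"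
    by (rule mult_mat_vec_carrier[OF trend_filter_mat_carrier v])
  have "?w $ 0 = 0" if "q - Suc k > 0"
    using that Suc.prems(2) by (intro trend_filter_local[OF v]) auto
  then have "?w = 0\<^sub>v (q - Suc k)"
    using Suc.prems(1) unfolding trend_filter_mult_vec_Suc[OF v] by (intro first_diff_null[OF c]) auto
  then show ?case using Suc by simp
qed

lemma coord_determined_trend_filter:
  "k + 1 \<le> p \<Longrightarrow> coord_determined p (trend_filter_mat p k) {..k}"
  using trend_filter_mat_carrier[of p k] trend_filter_null[of _ p k] by (auto simp: coord_determined_def)

section \<open>Graph penalties\<close>

lemma incidence_mat_carrier: "incidence_mat p es \<in> carrier_mat (length es) p"
  by (simp add: incidence_mat_def)

lemma incidence_mult_vec:
  assumes v: "v \<in> carrier_vec p" and e: "e < length es" "es ! e = (i, j)" and ij: "i < p" "j < p" "i \<noteq> j"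
  shows "(incidence_mat p es *\<^sub>v v) $ e = v $ j - v $ i"
proof -
  have "(incidence_mat p es *\<^sub>v v) $ e = (\<Sum>l<p. incidence_mat p es $$ (e, l) * v $ l)"
    by (rule mult_mat_vec_index_sum[OF incidence_mat_carrier v e(1)])
  also have "\<dots> = (\<Sum>l<p. (if l = j then v $ l else 0) - (if l = i then v $ l else 0))"
    using e ij by (intro sum.cong refl) (auto simp: incidence_mat_def)
  also have "\<dots> = v $ j - v $ i" using ij by (simp add: sum_subtractf)
  finally show ?thesis .
qed

text \<open>A null vector agrees at the two ends of each edge, hence along each walk. The list
  \<open>es\<close> holds each edge in one orientation only, so the reverse arcs are treated by
  symmetry.\<close>

lemma incidence_null_reachable:
  assumes G: "graph_on p G es" and v: "v \<in> carrier_vec p"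
    and 0: "incidence_mat p es *\<^sub>v v = 0\<^sub>v (length es)" and r: "a \<rightarrow>\<^sup>*\<^bsub>with_proj G\<^esub> b"
  shows "v $ a = v $ b"
proof -
  interpret pair_graph G using G by (simp add: graph_on_def)
  have less: "v $ i = v $ j" if "(i, j) \<in> parcs G" "i < j" for i j
  proof -
    have "(i, j) \<in> set es" using that G by (auto simp: graph_on_def)
    then obtain e where e: "e < length es" "es ! e = (i, j)" by (auto simp: in_set_conv_nth)
    have "i < p" "j < p" using that(1) in_arcsD1[of i j] in_arcsD2[of i j] G by (auto simp: graph_on_def)
    then show ?thesis using incidence_mult_vec[OF v e] that e by (simp add: 0)
  qed
  have arc: "v $ i = v $ j" if "(i, j) \<in> parcs G" for i j
  proof -
    have "(j, i) \<in> parcs G" using that pair_sym_arcs by (auto simp: symmetric_def sym_def)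
    moreover have "i \<noteq> j" using that pair_no_loops by fastforce
    ultimately show ?thesis using less that by (metis linorder_neqE_nat)
  qed
  from r show ?thesis
  proof (induction rule: reachable_induct)
    case (step x z)
    then show ?case using arc[of x z] by auto
  qed simp
qed

text \<open>Null vectors are constant on components, so one representative node per component
  determines them.\<close>

lemma coord_determined_incidence:
  assumes G: "graph_on p G es"
  shows "\<exists>S. card S \<le> num_components G \<and> coord_determined p (incidence_mat p es) S"
proof -
  interpret pair_graph G using G by (simp add: graph_on_def)
  have verts: "pverts G = {..<p}" using G by (simp add: graph_on_def)
  define rep where "rep C = (SOME u. u \<in> C)" for C :: "nat set"
  have rep: "rep C \<in> C" if "C \<in> sccs_verts" for C
  proof -
    have "C \<noteq> {}" by (rule conjunct1[OF that[unfolded in_sccs_verts_conv_reachable]])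
    then show ?thesis by (simp add: rep_def some_in_eq)
  qed
  have "card (rep ` sccs_verts) \<le> num_components G"
    using card_image_le[OF finite_sccs_verts, of rep] by (simp add: num_components_def card_sccs_verts)
  moreover have "coord_determined p (incidence_mat p es) (rep ` sccs_verts)"
    unfolding coord_determined_def
  proof (intro conjI ballI impI)
    show "dim_col (incidence_mat p es) = p" by (simp add: incidence_mat_def)
    show "rep ` sccs_verts \<subseteq> {..<p}" using rep sccs_verts_subsets verts by fastforce
    fix v :: "real vec" assume v: "v \<in> carrier_vec p"
      and 0: "incidence_mat p es *\<^sub>v v = 0\<^sub>v (dim_row (incidence_mat p es))"
      and S: "\<forall>i\<in>rep ` sccs_verts. v $ i = 0"
    have "v $ i = 0" if i: "i < p" for i
    proof -
      have C: "scc_of i \<in> sccs_verts" using i verts by (intro scc_of_in_sccs_verts) auto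
      then have "i \<rightarrow>\<^sup>*\<^bsub>with_proj G\<^esub> rep (scc_of i)" using rep[OF C] by (simp add: scc_of_def)
      then have "v $ i = v $ rep (scc_of i)"
        using 0 incidence_mat_carrier[of p es] by (intro incidence_null_reachable[OF G v]) auto
      then show ?thesis using S C by simp
    qed
    then show "v = 0\<^sub>v p" using v by (intro eq_vecI) auto
  qed
  ultimately show ?thesis by blast
qed

text \<open>The squared norm of \<open>A v\<close> equals the product of \<open>v\<close> with
  \<open>A\<^sup>T A v\<close>.\<close>

lemma transpose_mult_null:
  fixes A :: "real mat"
  assumes A: "A \<in> carrier_mat r c" and v: "v \<in> carrier_vec c"
    and 0: "transpose_mat A *\<^sub>v (A *\<^sub>v v) = 0\<^sub>v c"
  shows "A *\<^sub>v v = 0\<^sub>v r"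
proof -
  have Av: "A *\<^sub>v v \<in> carrier_vec r" using A v by simp
  have "(A *\<^sub>v v) \<bullet> (A *\<^sub>v v) = 0"
    using transpose_vec_mult_scalar[OF A v Av] v by (simp add: 0)
  then show ?thesis using vec_eq_0_iff_sprod_self[OF Av] by simp
qed

lemma graph_trend_filter_mat_carrier:
  "graph_trend_filter_mat p es k \<in> carrier_mat (if even k then length es else p) p"
proof (induction k)
  case 0
  then show ?case by (simp add: incidence_mat_carrier)
next
  case (Suc k)
  note I = incidence_mat_carrier[of p es]
  show ?case
  proof (cases "even k")
    case True
    then have "graph_trend_filter_mat p es k \<in> carrier_mat (length es) p" using Suc by simp
    then show ?thesis using True mult_carrier_mat[OF transpose_carrier_mat[THEN iffD2, OF I]] by simp
  next
    case False
    then have "graph_trend_filter_mat p es k \<in> carrier_mat p p" using Suc by simp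
    then show ?thesis using False mult_carrier_mat[OF I] by simp
  qed
qed

text \<open>From order two on, the two outermost factors are \<open>A\<^sup>T A\<close> with
  \<open>A\<close> the incidence matrix or its transpose, so the outermost one can be stripped from
  the null equation. Repeating this descends to order one.\<close>

lemma graph_trend_filter_null:
  assumes v: "v \<in> carrier_vec p"
  shows "graph_trend_filter_mat p es k *\<^sub>v v = 0\<^sub>v (if even k then length es else p) \<Longrightarrow>
    incidence_mat p es *\<^sub>v v = 0\<^sub>v (length es)"
proof (induction k)
  case (Suc k)
  let ?I = "incidence_mat p es" and ?T = "graph_trend_filter_mat p es"
  note I = incidence_mat_carrier[of p es]
  have IT: "transpose_mat ?I \<in> carrier_mat p (length es)" using I by simp
  have "?T k *\<^sub>v v = 0\<^sub>v (if even k then length es else p)"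
  proof (cases k)
    case 0
    then show ?thesis using Suc.prems assoc_mult_mat_vec[OF IT I v] transpose_mult_null[OF I v] by simp
  next
    case (Suc j)
    show ?thesis
    proof (cases "even k")
      \<comment> \<open>Here \<open>?I\<close> is the inner and its transpose the outer of the two
        factors; for odd \<open>k\<close> the roles are exchanged.\<close>
      case True
      then have j: "odd j" using Suc by simp
      then have T: "?T j \<in> carrier_mat p p" using graph_trend_filter_mat_carrier[of p es j] by simp
      define u where "u = ?T j *\<^sub>v v"
      have u: "u \<in> carrier_vec p" using T v by (simp add: u_def)
      have Tk: "?T k = ?I * ?T j" using Suc j by simp
      then have "?T (Suc k) *\<^sub>v v = transpose_mat ?I *\<^sub>v (?I *\<^sub>v u)"
        using True assoc_mult_mat_vec[OF IT mult_carrier_mat[OF I T] v] assoc_mult_mat_vec[OF I T v]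
        by (simp add: u_def)
      then have "?I *\<^sub>v u = 0\<^sub>v (length es)" using Suc.prems True by (intro transpose_mult_null[OF I u]) simp
      then show ?thesis using True Tk assoc_mult_mat_vec[OF I T v] by (simp add: u_def)
    next
      case False
      then have j: "even j" using Suc by simp
      then have T: "?T j \<in> carrier_mat (length es) p" using graph_trend_filter_mat_carrier[of p es j] by simp
      define u where "u = ?T j *\<^sub>v v"
      have u: "u \<in> carrier_vec (length es)" using T v by (simp add: u_def)
      have Tk: "?T k = transpose_mat ?I * ?T j" using Suc j by simp
      then have "?T (Suc k) *\<^sub>v v = transpose_mat (transpose_mat ?I) *\<^sub>v (transpose_mat ?I *\<^sub>v u)"
        using False assoc_mult_mat_vec[OF I mult_carrier_mat[OF IT T] v] assoc_mult_mat_vec[OF IT T v]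
        by (simp add: u_def)
      then have "transpose_mat ?I *\<^sub>v u = 0\<^sub>v p"
        using Suc.prems False by (intro transpose_mult_null[OF IT u]) simp
      then show ?thesis using False Tk assoc_mult_mat_vec[OF IT T v] by (simp add: u_def)
    qed
  qed
  then show ?case by (rule Suc.IH)
qed simp

lemma coord_determined_graph_trend_filter:
  assumes G: "graph_on p G es"
  shows "\<exists>S. card S \<le> num_components G \<and> coord_determined p (graph_trend_filter_mat p es k) S"
proof -
  obtain S where S: "card S \<le> num_components G" "coord_determined p (incidence_mat p es) S"
    using coord_determined_incidence[OF G] by blast
  have "coord_determined p (graph_trend_filter_mat p es k) S"
    using S(2) graph_trend_filter_null[of _ p es k] graph_trend_filter_mat_carrier[of p es k]
      incidence_mat_carrier[of p es]
    by (auto simp: coord_determined_def)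
  with S show ?thesis by blast
qed

section \<open>Kronecker penalties\<close>

lemma kronecker_carrier:
  "A \<in> carrier_mat ra ca \<Longrightarrow> B \<in> carrier_mat rb cb \<Longrightarrow> kronecker A B \<in> carrier_mat (ra * rb) (ca * cb)"
  by (simp add: kronecker_def)

lemma mixed_radix_less: "a < n \<Longrightarrow> b < m \<Longrightarrow> a * m + b < n * m" for a b n m :: nat
  using mult_le_mono1[of "Suc a" n m] by simp

text \<open>Reading the index of \<open>v\<close> as \<open>a * cb + b\<close> turns
  \<open>v\<close> into an array, where \<open>B\<close> acts on the inner digit and
  \<open>A\<close> on the outer one.\<close>

lemma kronecker_mult_vec:
  assumes A: "A \<in> carrier_mat ra ca" and B: "B \<in> carrier_mat rb cb" and v: "v \<in> carrier_vec (ca * cb)"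
    and i: "i1 < ra" "i2 < rb"
  shows "(kronecker A B *\<^sub>v v) $ (i1 * rb + i2) =
    (\<Sum>a<ca. A $$ (i1, a) * (\<Sum>b<cb. B $$ (i2, b) * v $ (a * cb + b)))"
proof -
  define h where "h j = A $$ (i1, j div cb) * B $$ (i2, j mod cb) * v $ j" for j
  have lt: "i1 * rb + i2 < ra * rb" using i by (rule mixed_radix_less)
  have "(kronecker A B *\<^sub>v v) $ (i1 * rb + i2) = (\<Sum>j\<in>{0..<ca * cb}. kronecker A B $$ (i1 * rb + i2, j) * v $ j)"
    using kronecker_carrier[OF A B] v lt by (simp add: scalar_prod_def)
  also have "\<dots> = (\<Sum>j\<in>{0..<ca * cb}. h j)"
    using A B i lt by (intro sum.cong refl) (simp add: kronecker_def h_def)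
  \<comment> \<open>The index range is cut into \<open>ca\<close> blocks of length
    \<open>cb\<close>, one for each outer digit.\<close>
  also have "\<dots> = (\<Sum>a<ca. sum h {a * cb..<a * cb + cb})"
    by (simp add: sum.nat_group atLeast0LessThan)
  also have "\<dots> = (\<Sum>a<ca. A $$ (i1, a) * (\<Sum>b<cb. B $$ (i2, b) * v $ (a * cb + b)))"
  proof (intro sum.cong refl)
    fix a
    have "sum h {a * cb..<a * cb + cb} = (\<Sum>b<cb. h (a * cb + b))"
      using sum.shift_bounds_nat_ivl[of h 0 "a * cb" cb] by (simp add: add.commute atLeast0LessThan)
    also have "\<dots> = (\<Sum>b<cb. A $$ (i1, a) * (B $$ (i2, b) * v $ (a * cb + b)))"
      by (intro sum.cong refl) (simp add: h_def mult.assoc)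
    finally show "sum h {a * cb..<a * cb + cb} = A $$ (i1, a) * (\<Sum>b<cb. B $$ (i2, b) * v $ (a * cb + b))"
      by (simp add: sum_distrib_left)
  qed
  finally show ?thesis .
qed

lemma kronecker_one_one: "kronecker (1\<^sub>m a) (1\<^sub>m b) = 1\<^sub>m (a * b)"
proof (rule eq_matI)
  fix i j assume ij: "i < dim_row (1\<^sub>m (a * b) :: real mat)" "j < dim_col (1\<^sub>m (a * b) :: real mat)"
  then have "b > 0" by (cases b) auto
  moreover have "i div b < a" "j div b < a" using ij by (auto simp: less_mult_imp_div_less)
  moreover have "i = j \<longleftrightarrow> i div b = j div b \<and> i mod b = j mod b" by (metis div_mult_mod_eq)
  ultimately show "kronecker (1\<^sub>m a) (1\<^sub>m b) $$ (i, j) = 1\<^sub>m (a * b) $$ (i, j)"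
    using ij by (simp add: kronecker_def)
qed (simp_all add: kronecker_def)

lemma kronecker_list_Cons: "kronecker_list (A # As) = kronecker A (kronecker_list As)"
  by (simp add: kronecker_list_def)

lemma kronecker_list_ones: "kronecker_list (replicate d (1\<^sub>m N)) = 1\<^sub>m (N ^ d)"
  by (induction d) (simp_all add: kronecker_list_Cons kronecker_one_one, simp add: kronecker_list_def)

lemma dim_col_kronecker_list:
  "(\<And>A. A \<in> set As \<Longrightarrow> dim_col A = N) \<Longrightarrow> dim_col (kronecker_list As) = N ^ length As"
  by (induction As) (simp_all add: kronecker_list_def kronecker_def)

text \<open>The identity factor leaves the inner digit \<open>b\<close> alone, so \<open>A\<close>
  acts separately on each fibre with \<open>b\<close> fixed.\<close>

lemma kronecker_one_right_null:
  assumes A: "A \<in> carrier_mat r N" and v: "v \<in> carrier_vec (N * M)"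
    and 0: "kronecker A (1\<^sub>m M) *\<^sub>v v = 0\<^sub>v (r * M)" and b: "b < M"
  shows "A *\<^sub>v vec N (\<lambda>a. v $ (a * M + b)) = 0\<^sub>v r"
proof (rule eq_vecI)
  fix i assume "i < dim_vec (0\<^sub>v r :: real vec)"
  then have i: "i < r" by simp
  have "0 = (kronecker A (1\<^sub>m M) *\<^sub>v v) $ (i * M + b)"
    using mixed_radix_less[OF i b] by (simp add: 0)
  also have "\<dots> = (\<Sum>a<N. A $$ (i, a) * (\<Sum>c<M. 1\<^sub>m M $$ (b, c) * v $ (a * M + c)))"
    by (rule kronecker_mult_vec[OF A one_carrier_mat v i b])
  also have "\<dots> = (\<Sum>a<N. A $$ (i, a) * v $ (a * M + b))"
  proof (intro sum.cong refl arg_cong2[of _ _ _ _ "(*)"])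
    fix a
    have "(\<Sum>c<M. 1\<^sub>m M $$ (b, c) * v $ (a * M + c)) = (\<Sum>c<M. if c = b then v $ (a * M + c) else 0)"
      using b by (intro sum.cong refl) auto
    then show "(\<Sum>c<M. 1\<^sub>m M $$ (b, c) * v $ (a * M + c)) = v $ (a * M + b)" using b by simp
  qed
  also have "\<dots> = (A *\<^sub>v vec N (\<lambda>a. v $ (a * M + b))) $ i"
    using A i by (simp add: scalar_prod_def atLeast0LessThan)
  finally show "(A *\<^sub>v vec N (\<lambda>a. v $ (a * M + b))) $ i = 0\<^sub>v r $ i" using i by simp
qed (use A in simp)

lemma kronecker_one_left_null:
  assumes B: "B \<in> carrier_mat r M" and v: "v \<in> carrier_vec (N * M)"
    and 0: "kronecker (1\<^sub>m N) B *\<^sub>v v = 0\<^sub>v (N * r)" and a: "a < N"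
  shows "B *\<^sub>v vec M (\<lambda>b. v $ (a * M + b)) = 0\<^sub>v r"
proof (rule eq_vecI)
  fix i assume "i < dim_vec (0\<^sub>v r :: real vec)"
  then have i: "i < r" by simp
  define w where "w c = (\<Sum>b<M. B $$ (i, b) * v $ (c * M + b))" for c
  have "0 = (kronecker (1\<^sub>m N) B *\<^sub>v v) $ (a * r + i)"
    using mixed_radix_less[OF a i] by (simp add: 0)
  also have "\<dots> = (\<Sum>c<N. 1\<^sub>m N $$ (a, c) * w c)"
    unfolding w_def by (rule kronecker_mult_vec[OF one_carrier_mat B v a i])
  also have "\<dots> = (\<Sum>c<N. if c = a then w c else 0)"
    using a by (intro sum.cong refl) auto
  also have "\<dots> = w a" using a by simp
  also have "\<dots> = (B *\<^sub>v vec M (\<lambda>b. v $ (a * M + b))) $ i"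
    using B i by (simp add: w_def scalar_prod_def atLeast0LessThan)
  finally show "(B *\<^sub>v vec M (\<lambda>b. v $ (a * M + b))) $ i = 0\<^sub>v r $ i" using i by simp
qed (use B in simp)

lemma stack_rows_carrier:
  "(\<And>A. A \<in> set As \<Longrightarrow> dim_col A = nc) \<Longrightarrow> \<exists>r. stack_rows nc As \<in> carrier_mat r nc"
proof (induction As)
  case Nil
  show ?case by (rule exI[of _ 0]) (simp add: stack_rows_def)
next
  case (Cons A As)
  then obtain r where "stack_rows nc As \<in> carrier_mat r nc" by auto
  moreover have "A \<in> carrier_mat (dim_row A) nc" using Cons.prems by auto
  ultimately show ?case using carrier_append_rows by (fastforce simp: stack_rows_def)
qed

lemma stack_rows_null:
  assumes v: "v \<in> carrier_vec nc"
  shows "(\<And>A. A \<in> set As \<Longrightarrow> dim_col A = nc) \<Longrightarrow>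
    stack_rows nc As *\<^sub>v v = 0\<^sub>v (dim_row (stack_rows nc As)) \<Longrightarrow> A \<in> set As \<Longrightarrow> A *\<^sub>v v = 0\<^sub>v (dim_row A)"
proof (induction As)
  case (Cons B Bs)
  obtain r where r: "stack_rows nc Bs \<in> carrier_mat r nc" using stack_rows_carrier[of Bs nc] Cons.prems by auto
  have B: "B \<in> carrier_mat (dim_row B) nc" using Cons.prems by auto
  have eq: "stack_rows nc (B # Bs) = B @\<^sub>r stack_rows nc Bs" by (simp add: stack_rows_def)
  have "(B *\<^sub>v v) @\<^sub>v (stack_rows nc Bs *\<^sub>v v) = 0\<^sub>v (dim_row B + r)"
    using Cons.prems(2) carrier_append_rows[OF B r] unfolding eq mat_mult_append[OF B r v] by simp
  then have 0: "((B *\<^sub>v v) @\<^sub>v (stack_rows nc Bs *\<^sub>v v)) $ i = 0" if "i < dim_row B + r" for i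
    using that by simp
  have "B *\<^sub>v v = 0\<^sub>v (dim_row B)"
  proof (rule eq_vecI)
    fix i assume "i < dim_vec (0\<^sub>v (dim_row B) :: real vec)"
    then show "(B *\<^sub>v v) $ i = 0\<^sub>v (dim_row B) $ i" using 0[of i] r by simp
  qed simp
  moreover have "stack_rows nc Bs *\<^sub>v v = 0\<^sub>v r"
  proof (rule eq_vecI)
    fix i assume "i < dim_vec (0\<^sub>v r :: real vec)"
    then show "(stack_rows nc Bs *\<^sub>v v) $ i = 0\<^sub>v r $ i" using 0[of "dim_row B + i"] r by simp
  qed (use r in simp)
  ultimately show ?case using Cons.IH Cons.prems r by auto
qed simp

text \<open>The indices in \<open>{0..<N^d}\<close> all of whose \<open>d\<close> digits in base \<open>N\<close> are at most \<open>k\<close>.\<close>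

primrec subgrid :: "nat \<Rightarrow> nat \<Rightarrow> nat \<Rightarrow> nat set" where
  "subgrid N k 0 = {0}"
| "subgrid N k (Suc d) = (\<lambda>(a, b). a * N ^ d + b) ` ({..k} \<times> subgrid N k d)"

lemma finite_subgrid: "finite (subgrid N k d)"
  by (induction d) auto

lemma card_subgrid: "card (subgrid N k d) \<le> (k + 1) ^ d"
proof (induction d)
  case (Suc d)
  have "card (subgrid N k (Suc d)) \<le> card ({..k} \<times> subgrid N k d)"
    unfolding subgrid.simps by (intro card_image_le finite_cartesian_product finite_subgrid) auto
  also have "\<dots> \<le> (k + 1) * (k + 1) ^ d" using Suc by (simp add: card_cartesian_product del: mult_Suc)
  finally show ?case by simp
qed simp

lemma subgrid_subset: "k < N \<Longrightarrow> subgrid N k d \<subseteq> {..<N ^ d}"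
proof (induction d)
  case (Suc d)
  then show ?case by (auto intro!: mixed_radix_less)
qed simp

text \<open>One block of the stacked penalty, with \<open>T\<close> independent of \<open>d\<close>,
  so that the leftmost factor can be split off in an induction on \<open>d\<close>.\<close>

definition kronecker_at :: "nat \<Rightarrow> nat \<Rightarrow> real mat \<Rightarrow> nat \<Rightarrow> real mat" where
  "kronecker_at N d T j = kronecker_list (map (\<lambda>i. if i = j then T else 1\<^sub>m N) [0..<d])"

lemma kronecker_at_0: "kronecker_at N (Suc d) T 0 = kronecker T (1\<^sub>m (N ^ d))"
proof -
  have "map (\<lambda>i. if i = 0 then T else 1\<^sub>m N) [0..<Suc d] = T # replicate d (1\<^sub>m N)"
    by (simp only: map_upt_Suc) (simp add: map_replicate_const)
  then show ?thesis by (simp only: kronecker_at_def kronecker_list_Cons kronecker_list_ones)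
qed

lemma kronecker_at_Suc: "kronecker_at N (Suc d) T (Suc j) = kronecker (1\<^sub>m N) (kronecker_at N d T j)"
  unfolding kronecker_at_def by (simp only: map_upt_Suc) (simp add: kronecker_list_Cons)

lemma dim_col_kronecker_at: "dim_col T = N \<Longrightarrow> dim_col (kronecker_at N d T j) = N ^ d"
  unfolding kronecker_at_def by (subst dim_col_kronecker_list[of _ N]) auto

text \<open>Induction on the number of factors: the factors 1, ..., d act on the slices of the first
  coordinate; the slices 0, ..., k vanish by induction, and then the first factor kills the rest.\<close>

lemma kronecker_at_null:
  assumes T: "T \<in> carrier_mat r N" and k: "k < N"
    and T0: "\<And>w. w \<in> carrier_vec N \<Longrightarrow> T *\<^sub>v w = 0\<^sub>v r \<Longrightarrow> (\<And>i. i \<le> k \<Longrightarrow> w $ i = 0) \<Longrightarrow> w = 0\<^sub>v N"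
  shows "v \<in> carrier_vec (N ^ d) \<Longrightarrow>
    (\<And>j. j < d \<Longrightarrow> kronecker_at N d T j *\<^sub>v v = 0\<^sub>v (dim_row (kronecker_at N d T j))) \<Longrightarrow>
    (\<And>i. i \<in> subgrid N k d \<Longrightarrow> v $ i = 0) \<Longrightarrow> v = 0\<^sub>v (N ^ d)"
proof (induction d arbitrary: v)
  case 0
  then show ?case by (auto intro!: eq_vecI)
next
  case (Suc d)
  let ?M = "N ^ d"
  have v: "v \<in> carrier_vec (N * ?M)" using Suc.prems(1) by simp
  \<comment> \<open>The leftmost factor carries the most significant digit, so \<open>a\<close> is
    the first grid coordinate.\<close>
  define slice where "slice a = vec ?M (\<lambda>b. v $ (a * ?M + b))" for a
  have slice: "slice a = 0\<^sub>v ?M" if a: "a \<le> k" for a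
  proof (rule Suc.IH)
    fix j assume j: "j < d"
    let ?B = "kronecker_at N d T j"
    have B: "?B \<in> carrier_mat (dim_row ?B) ?M" using T by (auto simp: dim_col_kronecker_at)
    have "kronecker (1\<^sub>m N) ?B *\<^sub>v v = 0\<^sub>v (N * dim_row ?B)"
      using Suc.prems(2)[of "Suc j"] j by (simp add: kronecker_at_Suc kronecker_def)
    then show "?B *\<^sub>v slice a = 0\<^sub>v (dim_row ?B)"
      unfolding slice_def using a k by (intro kronecker_one_left_null[OF B v]) auto
  next
    fix i assume i: "i \<in> subgrid N k d"
    then have "a * ?M + i \<in> subgrid N k (Suc d)" using a by (force simp: image_iff)
    then have "v $ (a * ?M + i) = 0" by (rule Suc.prems(3))
    moreover have "i < ?M" using i subgrid_subset[OF k, of d] by blast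
    ultimately show "slice a $ i = 0" by (simp add: slice_def)
  qed (simp add: slice_def)
  \<comment> \<open>Along the first coordinate the leading \<open>k + 1\<close> entries are zero by
    the slices, so \<open>T0\<close> applies.\<close>
  have fibre: "vec N (\<lambda>a. v $ (a * ?M + b)) = 0\<^sub>v N" if b: "b < ?M" for b
  proof (rule T0)
    have "kronecker T (1\<^sub>m ?M) *\<^sub>v v = 0\<^sub>v (r * ?M)"
      using Suc.prems(2)[of 0] T by (simp add: kronecker_at_0 kronecker_def)
    then show "T *\<^sub>v vec N (\<lambda>a. v $ (a * ?M + b)) = 0\<^sub>v r" by (rule kronecker_one_right_null[OF T v _ b])
    fix a assume a: "a \<le> k"
    then have "slice a $ b = 0" using slice b by simp
    then show "vec N (\<lambda>a. v $ (a * ?M + b)) $ a = 0" using a k b by (simp add: slice_def)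
  qed simp
  show ?case
  proof (rule eq_vecI)
    fix i assume "i < dim_vec (0\<^sub>v (N ^ Suc d) :: real vec)"
    then have i: "i < N * ?M" by simp
    then have "?M > 0" by (cases "?M") auto
    then have b: "i mod ?M < ?M" and a: "i div ?M < N" using i by (auto simp: less_mult_imp_div_less)
    have "vec N (\<lambda>a. v $ (a * ?M + i mod ?M)) $ (i div ?M) = 0"
      unfolding fibre[OF b] using a by simp
    then have "v $ (i div ?M * ?M + i mod ?M) = 0" unfolding index_vec[OF a] .
    then have "v $ i = 0" by (simp only: div_mult_mod_eq)
    then show "v $ i = 0\<^sub>v (N ^ Suc d) $ i" using i by simp
  qed (use v in simp)
qed

lemma coord_determined_kronecker:
  assumes k: "k + 1 \<le> N"
  shows "coord_determined (N ^ d) (kronecker_trend_filter_mat N d k) (subgrid N k d)"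
proof -
  let ?K = "kronecker_at N d (trend_filter_mat N k)"
  let ?P = "stack_rows (N ^ d) (map ?K [0..<d])"
  note T = trend_filter_mat_carrier[of N k]
  have eq: "kronecker_trend_filter_mat N d k = ?P"
    unfolding kronecker_trend_filter_mat_def kronecker_at_def ..
  have dim: "dim_col A = N ^ d" if "A \<in> set (map ?K [0..<d])" for A
    using that dim_col_kronecker_at[OF carrier_matD(2)[OF T]] by fastforce
  show ?thesis
    unfolding coord_determined_def eq
  proof (intro conjI ballI impI)
    show "dim_col ?P = N ^ d" using stack_rows_carrier[of "map ?K [0..<d]", OF dim] by auto
    show "subgrid N k d \<subseteq> {..<N ^ d}" using k by (intro subgrid_subset) simp
    fix v :: "real vec"
    assume v: "v \<in> carrier_vec (N ^ d)" and 0: "?P *\<^sub>v v = 0\<^sub>v (dim_row ?P)"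
      and S: "\<forall>i\<in>subgrid N k d. v $ i = 0"
    show "v = 0\<^sub>v (N ^ d)"
    proof (rule kronecker_at_null[OF T _ _ v])
      fix j assume j: "j < d"
      then show "?K j *\<^sub>v v = 0\<^sub>v (dim_row (?K j))"
        by (intro stack_rows_null[OF v _ 0] dim) auto
    qed (use k S trend_filter_null in auto)
  qed
qed

section \<open>Uniqueness for almost every design\<close>

lemma lin_subspace_sign_subspace:
  assumes D: "D \<in> carrier_mat m p"
  shows "lin_subspace p (sign_subspace D s)"
proof -
  have "(D *\<^sub>v (u + v)) $ i = (D *\<^sub>v u) $ i + (D *\<^sub>v v) $ i" "(D *\<^sub>v (c \<cdot>\<^sub>v v)) $ i = c * (D *\<^sub>v v) $ i"
    if "i < m" "u \<in> carrier_vec p" "v \<in> carrier_vec p" for i c u v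
    using that D by (simp_all add: mult_add_distrib_mat_vec[OF D] mult_mat_vec)
  note * = this
  have "(D *\<^sub>v 0\<^sub>v p) $ i = 0" if "i < m" for i using that D by simp
  moreover have "(\<Sum>i<m. s i * (D *\<^sub>v (u + v)) $ i) = (\<Sum>i<m. s i * (D *\<^sub>v u) $ i) + (\<Sum>i<m. s i * (D *\<^sub>v v) $ i)"
    "(\<Sum>i<m. s i * (D *\<^sub>v (c \<cdot>\<^sub>v v)) $ i) = c * (\<Sum>i<m. s i * (D *\<^sub>v v) $ i)"
    if "u \<in> carrier_vec p" "v \<in> carrier_vec p" for c u v
    unfolding sum.distrib[symmetric] sum_distrib_left
    using that * by (auto intro!: sum.cong simp: algebra_simps simp del: index_mult_mat_vec)
  ultimately show ?thesis
    using D * unfolding lin_subspace_def sign_subspace_def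
    by (auto simp del: index_mult_mat_vec)
qed

lemma lin_subspace_kernel:
  assumes D: "D \<in> carrier_mat m p"
  shows "lin_subspace p {v \<in> carrier_vec p. D *\<^sub>v v = 0\<^sub>v m}"
  using D by (auto simp: lin_subspace_def mult_add_distrib_mat_vec[OF D] mult_mat_vec[OF D])

text \<open>Unit vectors at the coordinates in \<open>S\<close>, padded with zero rows up to
  \<open>n\<close>, form a design that reads off exactly these coordinates.\<close>

lemma coord_determined_injective_design:
  assumes S: "coord_determined p D S" and n: "card S \<le> n"
  obtains X0 where "X0 \<in> carrier_mat n p"
    "inj_on_subspace X0 {v \<in> carrier_vec p. D *\<^sub>v v = 0\<^sub>v (dim_row D)}"
proof -
  have sub: "S \<subseteq> {..<p}" using S by (simp add: coord_determined_def)
  then have "finite S" by (rule finite_subset) simp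
  then obtain f where f: "bij_betw f {0..<card S} S" using ex_bij_betw_nat_finite by blast
  define X0 :: "real mat" where "X0 = mat n p (\<lambda>(i, j). if i < card S \<and> j = f i then 1 else 0)"
  have "v = 0\<^sub>v p" if v: "v \<in> carrier_vec p" "D *\<^sub>v v = 0\<^sub>v (dim_row D)" "X0 *\<^sub>v v = 0\<^sub>v n" for v
  proof -
    have "v $ j = 0" if j: "j \<in> S" for j
    proof -
      have "j \<in> f ` {0..<card S}" using f j by (simp add: bij_betw_def)
      then obtain i where i: "i < card S" "j = f i" by auto
      have "j < p" using sub j by auto
      have "0 = (X0 *\<^sub>v v) $ i" using i n by (simp add: v(3))
      also have "\<dots> = (\<Sum>l<p. X0 $$ (i, l) * v $ l)"
        using i n by (intro mult_mat_vec_index_sum[of X0 n p]) (auto simp: X0_def v(1))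
      also have "\<dots> = (\<Sum>l<p. if l = j then v $ l else 0)"
        using i n by (intro sum.cong refl) (auto simp: X0_def)
      finally show ?thesis using \<open>j < p\<close> by simp
    qed
    then show ?thesis using S v by (simp add: coord_determined_def)
  qed
  then show thesis by (intro that[of X0]) (auto simp: X0_def inj_on_subspace_def)
qed

text \<open>The exceptional set is a finite union, from the kernel and from each sign vector, and is
  fixed before \<open>y\<close>; no uncountable union over responses arises.\<close>

lemma AE_gen_lasso_unique:
  assumes lam: "lam > 0" and S: "coord_determined p D S" and n: "card S \<le> n"
  shows "AE x in (\<Pi>\<^sub>M ij\<in>{..<n} \<times> {..<p}. lborel).
    \<forall>y\<in>carrier_vec n. \<exists>!b. gen_lasso_solution lam D (mat n p x) y b"
proof -
  define m where "m = dim_row D"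
  have D: "D \<in> carrier_mat m p" using S by (auto simp: coord_determined_def m_def)
  let ?K = "{v \<in> carrier_vec p. D *\<^sub>v v = 0\<^sub>v m}" and ?S = "{..<m} \<rightarrow>\<^sub>E {-1, 0, 1 :: real}"
  obtain X0 where "X0 \<in> carrier_mat n p" "inj_on_subspace X0 ?K"
    using coord_determined_injective_design[OF S n] unfolding m_def by blast
  then have "AE x in (\<Pi>\<^sub>M ij\<in>{..<n} \<times> {..<p}. lborel). inj_on_subspace (mat n p x) ?K"
    by (rule generic_injective[OF lin_subspace_kernel[OF D]])
  moreover have "AE x in (\<Pi>\<^sub>M ij\<in>{..<n} \<times> {..<p}. lborel). \<forall>s\<in>?S.
      inj_on_subspace (mat n p x) (sign_subspace D s) \<or>
      (\<forall>b\<in>carrier_vec n. \<exists>v\<in>sign_subspace D s. mat n p x *\<^sub>v v = b)"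
    by (intro AE_finite_allI finite_PiE generic_full_rank lin_subspace_sign_subspace[OF D]) auto
  ultimately show ?thesis
  proof eventually_elim
    case (elim x)
    have X: "mat n p x \<in> carrier_mat n p" by simp
    show ?case
    proof
      fix y :: "real vec" assume y: "y \<in> carrier_vec n"
      obtain b where b: "gen_lasso_solution lam D (mat n p x) y b"
        using gen_lasso_solution_exists[OF lam X D y elim(1)] by blast
      show "\<exists>!b. gen_lasso_solution lam D (mat n p x) y b"
      proof (rule ex1I[of _ b])
        show "gen_lasso_solution lam D (mat n p x) y b" by (rule b)
        fix c assume c: "gen_lasso_solution lam D (mat n p x) y c"
        show "c = b"
          by (rule gen_lasso_solution_unique[OF lam X D y elim(1) bspec[OF elim(2)] c b])
      qed
    qed
  qed
qed

text \<open>A null set times the whole second space is null even if that space has infinite measure,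
  since \<open>0 * \<infinity> = 0\<close> for extended nonnegative reals.\<close>

lemma AE_pair_fst:
  assumes "sigma_finite_measure N" and "AE x in M. P x"
  shows "AE z in M \<Otimes>\<^sub>M N. P (fst z)"
proof -
  interpret N: sigma_finite_measure N by fact
  obtain A where A: "A \<in> null_sets M" "{x \<in> space M. \<not> P x} \<subseteq> A"
    using assms(2) by (auto simp: eventually_ae_filter)
  have "A \<times> space N \<in> null_sets (M \<Otimes>\<^sub>M N)"
    using A(1) by (auto simp: null_sets_def N.emeasure_pair_measure_Times)
  moreover have "{z \<in> space (M \<Otimes>\<^sub>M N). \<not> P (fst z)} \<subseteq> A \<times> space N"
    using A(2) by (auto simp: space_pair_measure)
  ultimately show ?thesis by (rule AE_I')
qed

lemma AE_lborel_design_gen_lasso_unique: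
  assumes "lam > 0" "coord_determined p D S" "card S \<le> n"
  shows "AE z in lborel_design n p. \<forall>y\<in>carrier_vec n. \<exists>!b. gen_lasso_solution lam D (mat n p (fst z)) y b"
proof -
  interpret product_sigma_finite "\<lambda>_. lborel :: real measure" ..
  have "sigma_finite_measure (\<Pi>\<^sub>M i\<in>{..<n}. (lborel :: real measure))" by (rule sigma_finite) simp
  then show ?thesis unfolding lborel_design_def
    by (rule AE_pair_fst) (rule AE_gen_lasso_unique[OF assms])
qed

lemma coord_determined_cases:
  assumes dims: "n \<ge> 1" "p \<ge> 1"
    and D: "D = 1\<^sub>m p
      \<or> D = first_diff_mat p
      \<or> (\<exists>k. k + 1 \<le> p \<and> D = trend_filter_mat p k \<and> n \<ge> k + 1)
      \<or> (\<exists>G es. graph_on p G es \<and> D = incidence_mat p es \<and> n \<ge> num_components G)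
      \<or> (\<exists>G es k. graph_on p G es \<and> D = graph_trend_filter_mat p es k \<and> n \<ge> num_components G)
      \<or> (\<exists>N d k. d \<ge> 1 \<and> k + 1 \<le> N \<and> p = N ^ d \<and> D = kronecker_trend_filter_mat N d k
           \<and> n \<ge> (k + 1) ^ d)"
  shows "\<exists>S. card S \<le> n \<and> coord_determined p D S"
  using D
proof (elim disjE exE conjE)
  assume "D = 1\<^sub>m p"
  then show ?thesis using coord_determined_one by (intro exI[of _ "{}"]) auto
next
  assume "D = first_diff_mat p"
  \<comment> \<open>The first difference matrix is the case \<open>k = 0\<close>, so the single
    coordinate 0 suffices, which \<open>n \<ge> 1\<close> allows.\<close>
  then show ?thesis using coord_determined_trend_filter[of 0 p] dims by (intro exI[of _ "{..0}"]) auto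
next
  fix k assume "k + 1 \<le> p" "D = trend_filter_mat p k" "n \<ge> k + 1"
  then show ?thesis using coord_determined_trend_filter[of k p] by (intro exI[of _ "{..k}"]) auto
next
  fix G es assume "graph_on p G es" "D = incidence_mat p es" "n \<ge> num_components G"
  then show ?thesis using coord_determined_incidence order_trans by blast
next
  fix G es k assume "graph_on p G es" "D = graph_trend_filter_mat p es k" "n \<ge> num_components G"
  then show ?thesis using coord_determined_graph_trend_filter order_trans by blast
next
  fix N d k assume "k + 1 \<le> N" "p = N ^ d" "D = kronecker_trend_filter_mat N d k" "n \<ge> (k + 1) ^ d"
  then show ?thesis
    using coord_determined_kronecker[of k N d] card_subgrid[of N k d] by (intro exI[of _ "subgrid N k d"]) auto
qed

theorem corollary1:
  fixes lam :: real and n p :: nat and D :: "real mat"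
    and M :: "'w measure" and X :: "'w \<Rightarrow> real mat" and y :: "'w \<Rightarrow> real vec"
  assumes lam: "lam > 0"
    and dims: "n \<ge> 1" "p \<ge> 1"
    and M: "prob_space M"
    and X: "\<And>\<omega>. \<omega> \<in> space M \<Longrightarrow> X \<omega> \<in> carrier_mat n p"
    and y: "\<And>\<omega>. \<omega> \<in> space M \<Longrightarrow> y \<omega> \<in> carrier_vec n"
    and meas: "(\<lambda>\<omega>. design_coords (X \<omega>) (y \<omega>)) \<in> M \<rightarrow>\<^sub>M lborel_design n p"
    and ac: "absolutely_continuous (lborel_design n p)
               (distr M (lborel_design n p) (\<lambda>\<omega>. design_coords (X \<omega>) (y \<omega>)))"
    and D: "D = 1\<^sub>m p
      \<or> D = first_diff_mat p
      \<or> (\<exists>k. k + 1 \<le> p \<and> D = trend_filter_mat p k \<and> n \<ge> k + 1)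
      \<or> (\<exists>G es. graph_on p G es \<and> D = incidence_mat p es \<and> n \<ge> num_components G)
      \<or> (\<exists>G es k. graph_on p G es \<and> D = graph_trend_filter_mat p es k \<and> n \<ge> num_components G)
      \<or> (\<exists>N d k. d \<ge> 1 \<and> k + 1 \<le> N \<and> p = N ^ d \<and> D = kronecker_trend_filter_mat N d k
           \<and> n \<ge> (k + 1) ^ d)"
  shows "AE \<omega> in M. \<exists>!\<beta>. gen_lasso_solution lam D (X \<omega>) (y \<omega>) \<beta>"
proof -
  obtain S where S: "coord_determined p D S" "card S \<le> n"
    using coord_determined_cases[OF dims D] by blast
  let ?Z = "\<lambda>\<omega>. design_coords (X \<omega>) (y \<omega>)"
  \<comment> \<open>Absolute continuity transfers the almost everywhere statement from Lebesgue
    measure to the law of the data.\<close>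
  have "AE z in distr M (lborel_design n p) ?Z.
      \<forall>y\<in>carrier_vec n. \<exists>!b. gen_lasso_solution lam D (mat n p (fst z)) y b"
    by (rule absolutely_continuous_AE[OF _ ac AE_lborel_design_gen_lasso_unique[OF lam S]]) simp
  then have "AE \<omega> in M. \<forall>y\<in>carrier_vec n. \<exists>!b. gen_lasso_solution lam D (mat n p (fst (?Z \<omega>))) y b"
    by (rule AE_distrD[OF meas])
  then show ?thesis
  proof (rule AE_mp, intro AE_I2 impI)
    fix \<omega> assume \<omega>: "\<omega> \<in> space M"
      and *: "\<forall>y\<in>carrier_vec n. \<exists>!b. gen_lasso_solution lam D (mat n p (fst (?Z \<omega>))) y b"
    \<comment> \<open>The restriction in \<open>design_coords\<close> leaves all entries within the
      dimensions intact, so the design is recovered from its coordinates.\<close>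
    have "mat n p (fst (?Z \<omega>)) = X \<omega>"
      using X[OF \<omega>] by (intro eq_matI) (auto simp: design_coords_def)
    then show "\<exists>!\<beta>. gen_lasso_solution lam D (X \<omega>) (y \<omega>) \<beta>" using * y[OF \<omega>] by simp
  qed
qed

end
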